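(* Let $k\ge1$, $a_i,b_i,c_i\in\mathbb{C}$ ($1\le i\le k$), let $T(f)$ be the tridiagonal $k$-Toeplitz operator on $\ell^2(\mathbb{N})$ with symbol $f$, and let $B_0$ denote the leading $(k-1)\times(k-1)$ principal submatrix of $A_0$. Then $$\sigma_{\det}(f)\cup\sigma_{\mathrm{wind}}(f)\subset\sigma(T(f))\subset\sigma_{\det}(f)\cup\sigma_{\mathrm{wind}}(f)\cup\sigma(B_0).$$
   Context: The tridiagonal $k$-Toeplitz operator $T(f)$ on $\ell^2(\mathbb{N})$ has matrix entries $(i,i)=a_{p(i)}$, $(i,i+1)=b_{p(i)}$, $(i+1,i)=c_{p(i)}$, $p(i)=((i-1)\bmod k)+1$, all other entries zero. Its symbol is $f(z)=A_{-1}z^{-1}+A_0+A_1z$ ($z\in\mathbb{C}\setminus\{0\}$), where $A_0$ is the $k\times k$ tridiagonal matrix with diagonal $a_1,\dots,a_k$, superdiagonal $b_1,\dots,b_{k-1}$, subdiagonal $c_1,\dots,c_{k-1}$; $A_{-1}$ has single nonzero entry $b_k$ at $(k,1)$; $A_1$ has single nonzero entry $c_k$ at $(1,k)$. $\mathbb{T}$ is the unit circle. $\sigma_{\det}(f)=\{\lambda\in\mathbb{C}: \det(f(z)-\lambda I)=0 \text{ for some } z\in\mathbb{T}\}$. Let $\lambda_1(z),\dots,\lambda_k(z)$ be the eigenvalues of $f(z)$; for $\lambda\notin\sigma_{\det}(f)$, $\sum_{j=1}^k\operatorname{wind}(\lambda_j(\mathbb{T}),\lambda)$ denotes the winding number about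 $0$ of the closed curve $z\mapsto\det(f(z)-\lambda I)=\prod_{j}(\lambda_j(z)-\lambda)$ as $z$ traverses $\mathbb{T}$ counterclockwise. Then $\sigma_{\mathrm{wind}}(f)=\{\lambda\in\mathbb{C}\setminus\sigma_{\det}(f): \sum_{j=1}^k\operatorname{wind}(\lambda_j(\mathbb{T}),\lambda)\neq0\}$. $\sigma(\cdot)$ denotes the spectrum. *)

theory Defs
  imports "HOL-Complex_Analysis.Complex_Analysis" "Jordan_Normal_Form.Char_Poly"
begin

(* Coefficients a, b, c are indexed 1..k as in the paper.
   Sequences in l^2(N) are indexed from 0: position j (0-based) corresponds to the
   paper's index i = j+1, so p(i) = (j mod k) + 1. *)

definition l2 :: "(nat \<Rightarrow> complex) set" where
  "l2 = {x. summable (\<lambda>n. (cmod (x n))\<^sup>2)}"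

definition l2norm :: "(nat \<Rightarrow> complex) \<Rightarrow> real" where
  "l2norm x = sqrt (\<Sum>n. (cmod (x n))\<^sup>2)"

definition pidx :: "nat \<Rightarrow> nat \<Rightarrow> nat" where
  "pidx k j = (j mod k) + 1"

definition ktoep :: "nat \<Rightarrow> (nat \<Rightarrow> complex) \<Rightarrow> (nat \<Rightarrow> complex) \<Rightarrow> (nat \<Rightarrow> complex)
    \<Rightarrow> (nat \<Rightarrow> complex) \<Rightarrow> (nat \<Rightarrow> complex)" where
  "ktoep k a b c x = (\<lambda>j. a (pidx k j) * x j + b (pidx k j) * x (Suc j)
      + (if j = 0 then 0 else c (pidx k (j - 1)) * x (j - 1)))"

definition op_spectrum :: "((nat \<Rightarrow> complex) \<Rightarrow> (nat \<Rightarrow> complex)) \<Rightarrow> complex set" where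
  "op_spectrum T = {mu. \<not> (\<exists>S. (\<forall>x\<in>l2. S x \<in> l2)
        \<and> (\<exists>C. \<forall>x\<in>l2. l2norm (S x) \<le> C * l2norm x)
        \<and> (\<forall>x\<in>l2. S (\<lambda>j. T x j - mu * x j) = x
                  \<and> (\<lambda>j. T (S x) j - mu * S x j) = x))}"

text \<open>Symbol matrices (0-based matrix indices; the paper's (i,j) is (i-1,j-1) here).\<close>
definition A0 :: "nat \<Rightarrow> (nat \<Rightarrow> complex) \<Rightarrow> (nat \<Rightarrow> complex) \<Rightarrow> (nat \<Rightarrow> complex) \<Rightarrow> complex mat" where
  "A0 k a b c = mat k k (\<lambda>(i,j). if i = j then a (i+1)
      else if j = i + 1 then b (i+1)
      else if i = j + 1 then c (j+1) else 0)"

definition Am1 :: "nat \<Rightarrow> (nat \<Rightarrow> complex) \<Rightarrow> complex mat" where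
  "Am1 k b = mat k k (\<lambda>(i,j). if i = k - 1 \<and> j = 0 then b k else 0)"

definition Ap1 :: "nat \<Rightarrow> (nat \<Rightarrow> complex) \<Rightarrow> complex mat" where
  "Ap1 k c = mat k k (\<lambda>(i,j). if i = 0 \<and> j = k - 1 then c k else 0)"

definition symb :: "nat \<Rightarrow> (nat \<Rightarrow> complex) \<Rightarrow> (nat \<Rightarrow> complex) \<Rightarrow> (nat \<Rightarrow> complex) \<Rightarrow> complex \<Rightarrow> complex mat" where
  "symb k a b c z = (inverse z) \<cdot>\<^sub>m Am1 k b + A0 k a b c + z \<cdot>\<^sub>m Ap1 k c"

definition sigma_det :: "nat \<Rightarrow> (nat \<Rightarrow> complex) \<Rightarrow> (nat \<Rightarrow> complex) \<Rightarrow> (nat \<Rightarrow> complex) \<Rightarrow> complex set" where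
  "sigma_det k a b c = {mu. \<exists>z. cmod z = 1 \<and> det (symb k a b c z - mu \<cdot>\<^sub>m 1\<^sub>m k) = 0}"

definition sigma_wind :: "nat \<Rightarrow> (nat \<Rightarrow> complex) \<Rightarrow> (nat \<Rightarrow> complex) \<Rightarrow> (nat \<Rightarrow> complex) \<Rightarrow> complex set" where
  "sigma_wind k a b c = {mu. mu \<notin> sigma_det k a b c \<and>
      winding_number (\<lambda>t. det (symb k a b c (cis (2 * pi * t)) - mu \<cdot>\<^sub>m 1\<^sub>m k)) 0 \<noteq> 0}"

definition B0 :: "nat \<Rightarrow> (nat \<Rightarrow> complex) \<Rightarrow> (nat \<Rightarrow> complex) \<Rightarrow> (nat \<Rightarrow> complex) \<Rightarrow> complex mat" where
  "B0 k a b c = mat (k - 1) (k - 1) (\<lambda>(i,j). A0 k a b c $$ (i,j))"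

end

theory Submission
  imports Defs
begin

text \<open>
  Let \<open>f(z) - \<mu>\<close> have determinant \<open>q(z) / z\<close>; here \<open>q\<close> is a polynomial of degree at most two, because
  \<open>z\<close> and \<open>z\<inverse>\<close> occur in a single entry each. A zero of \<open>q\<close> on the unit circle yields a bounded
  generalized eigenvector, hence a singular Weyl sequence. Otherwise the winding number is the number
  of zeros of \<open>q\<close> in the open disk minus one. If \<open>q\<close> has no zeros there, the Taylor coefficients of the
  last column of \<open>z\<inverse> (f(z) - \<mu>)\<inverse>\<close> form an eigenvector of \<open>T(f)\<close>; if \<open>q\<close> has two zeros, the same
  argument for the transposed operator produces a vector annihilating the range. If \<open>q\<close> has one zero
  and \<open>B\<^sub>0 - \<mu>\<close> is invertible, the Schur complement of \<open>B\<^sub>0 - \<mu>\<close> reduces \<open>T(f) - \<mu>\<close> to a scalar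
  tridiagonal Toeplitz operator of the form \<open>C (1 - r L) (1 - s R)\<close> with \<open>L\<close>, \<open>R\<close> the two shifts and
  \<open>|r|, |s| < 1\<close>, which is inverted by Neumann series.
\<close>

section \<open>Square-summable sequences and bounded operators\<close>

lemma L2_set_le_l2norm:
  assumes "x \<in> l2"
  shows "L2_set (\<lambda>n. cmod (x n)) {..<N} \<le> l2norm x"
  using assms unfolding l2_def l2norm_def L2_set_def
  by (intro real_sqrt_le_mono sum_le_suminf) auto

lemma l2_boundedI:
  assumes "\<And>N. L2_set (\<lambda>n. cmod (x n)) {..<N} \<le> B"
  shows "x \<in> l2" "l2norm x \<le> B"
proof -
  have B: "B \<ge> 0" using assms[of 0] by simp
  have le: "(\<Sum>n<N. (cmod (x n))\<^sup>2) \<le> B\<^sup>2" for N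
    using assms[of N] unfolding L2_set_def by (simp add: sqrt_le_D)
  then have s: "summable (\<lambda>n. (cmod (x n))\<^sup>2)"
    by (intro summableI_nonneg_bounded[of _ "B\<^sup>2"]) auto
  then show "x \<in> l2" by (simp add: l2_def)
  show "l2norm x \<le> B"
    unfolding l2norm_def using suminf_le_const[OF s le] B by (simp add: real_le_lsqrt)
qed

lemma l2norm_nonneg: "x \<in> l2 \<Longrightarrow> l2norm x \<ge> 0"
  unfolding l2norm_def l2_def by (auto intro: suminf_nonneg)

lemma cmod_le_l2norm: "x \<in> l2 \<Longrightarrow> cmod (x n) \<le> l2norm x"
  using member_le_L2_set[of "{..<Suc n}" n "\<lambda>n. cmod (x n)"] L2_set_le_l2norm[of x "Suc n"] by simp

lemma l2norm_le_0_imp: "x \<in> l2 \<Longrightarrow> l2norm x \<le> 0 \<Longrightarrow> x n = 0"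
  using cmod_le_l2norm[of x n] norm_ge_zero[of "x n"] by (metis norm_le_zero_iff order.trans)

lemma zero_l2 [simp]: "(\<lambda>n. 0) \<in> l2" by (simp add: l2_def)

lemma l2norm_zero [simp]: "l2norm (\<lambda>n. 0) = 0" by (simp add: l2norm_def)

lemma L2_set_cmod_add_le:
  "L2_set (\<lambda>n. cmod (x n + y n)) A \<le> L2_set (\<lambda>n. cmod (x n)) A + L2_set (\<lambda>n. cmod (y n)) A"
  by (rule order.trans[OF L2_set_mono L2_set_triangle_ineq]) (auto intro: norm_triangle_ineq)

lemma L2_set_cmod_scale:
  "L2_set (\<lambda>n. cmod (c * x n)) A = cmod c * L2_set (\<lambda>n. cmod (x n)) A"
  by (simp add: norm_mult L2_set_right_distrib)

lemma l2_add:
  assumes "x \<in> l2" "y \<in> l2"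
  shows "(\<lambda>n. x n + y n) \<in> l2" "l2norm (\<lambda>n. x n + y n) \<le> l2norm x + l2norm y"
proof -
  have "L2_set (\<lambda>n. cmod (x n + y n)) {..<N} \<le> l2norm x + l2norm y" for N
    using L2_set_cmod_add_le[of x y "{..<N}"] L2_set_le_l2norm[OF assms(1), of N]
      L2_set_le_l2norm[OF assms(2), of N] by linarith
  from l2_boundedI[OF this]
  show "(\<lambda>n. x n + y n) \<in> l2" "l2norm (\<lambda>n. x n + y n) \<le> l2norm x + l2norm y" .
qed

lemma l2_scale:
  assumes "x \<in> l2"
  shows "(\<lambda>n. c * x n) \<in> l2" "l2norm (\<lambda>n. c * x n) \<le> cmod c * l2norm x"
  using l2_boundedI[of "\<lambda>n. c * x n" "cmod c * l2norm x"] L2_set_le_l2norm[OF assms]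
  by (auto simp: L2_set_cmod_scale mult_left_mono)

lemma l2_diff:
  assumes "x \<in> l2" "y \<in> l2"
  shows "(\<lambda>n. x n - y n) \<in> l2"
  using l2_add(1)[OF assms(1) l2_scale(1)[OF assms(2), of "-1"]] by simp

lemma finite_support_l2:
  fixes M :: real
  assumes "finite F" "\<And>n. n \<notin> F \<Longrightarrow> x n = 0" "\<And>n. cmod (x n) \<le> M"
  shows "x \<in> l2" "l2norm x \<le> card F * M"
proof -
  have M: "M \<ge> 0" using assms(3)[of 0] norm_ge_zero order.trans by blast
  have "L2_set (\<lambda>n. cmod (x n)) {..<N} \<le> card F * M" for N
  proof -
    have "L2_set (\<lambda>n. cmod (x n)) {..<N} \<le> (\<Sum>n<N. cmod (x n))"
      by (rule L2_set_le_sum) auto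
    also have "\<dots> = (\<Sum>n\<in>{..<N} \<inter> F. cmod (x n))"
      by (rule sum.mono_neutral_right) (use assms(2) in auto)
    also have "\<dots> \<le> (\<Sum>n\<in>F. cmod (x n))"
      by (rule sum_mono2) (use assms(1) in auto)
    also have "\<dots> \<le> card F * M" using sum_bounded_above[of F "\<lambda>n. cmod (x n)" M] assms(3) by simp
    finally show ?thesis .
  qed
  then show "x \<in> l2" "l2norm x \<le> card F * M" using l2_boundedI by blast+
qed

definition lshift :: "(nat \<Rightarrow> complex) \<Rightarrow> nat \<Rightarrow> complex" where
  "lshift x = (\<lambda>n. x (Suc n))"

definition rshift :: "(nat \<Rightarrow> complex) \<Rightarrow> nat \<Rightarrow> complex" where
  "rshift x = (\<lambda>n. if n = 0 then 0 else x (n - 1))"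

lemma L2_set_lshift_le:
  "L2_set (\<lambda>n. cmod (lshift x n)) {..<N} \<le> L2_set (\<lambda>n. cmod (x n)) {..<Suc N}"
  unfolding L2_set_def lshift_def
  by (subst sum.lessThan_Suc_shift) simp

lemma L2_set_rshift_le:
  "L2_set (\<lambda>n. cmod (rshift x n)) {..<N} \<le> L2_set (\<lambda>n. cmod (x n)) {..<N}"
proof (cases N)
  case (Suc M)
  show ?thesis unfolding L2_set_def rshift_def Suc
    by (subst sum.lessThan_Suc_shift) (simp add: sum.lessThan_Suc)
qed simp

lemma l2_lshift:
  assumes "x \<in> l2"
  shows "lshift x \<in> l2" "l2norm (lshift x) \<le> l2norm x"
  using l2_boundedI[of "lshift x", OF order.trans[OF L2_set_lshift_le L2_set_le_l2norm[OF assms]]] by auto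

lemma l2_rshift:
  assumes "x \<in> l2"
  shows "rshift x \<in> l2" "l2norm (rshift x) \<le> l2norm x"
  using l2_boundedI[of "rshift x", OF order.trans[OF L2_set_rshift_le L2_set_le_l2norm[OF assms]]] by auto

definition bounded_op :: "((nat \<Rightarrow> complex) \<Rightarrow> (nat \<Rightarrow> complex)) \<Rightarrow> bool" where
  "bounded_op A \<longleftrightarrow> (\<exists>C. \<forall>x\<in>l2. A x \<in> l2 \<and> l2norm (A x) \<le> C * l2norm x)"

lemma bounded_opI:
  "(\<And>x. x \<in> l2 \<Longrightarrow> A x \<in> l2) \<Longrightarrow> (\<And>x. x \<in> l2 \<Longrightarrow> l2norm (A x) \<le> C * l2norm x) \<Longrightarrow> bounded_op A"
  unfolding bounded_op_def by blast

lemma bounded_opD: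
  assumes "bounded_op A"
  shows "\<exists>C\<ge>0. \<forall>x\<in>l2. A x \<in> l2 \<and> l2norm (A x) \<le> C * l2norm x"
proof -
  obtain C where C: "\<forall>x\<in>l2. A x \<in> l2 \<and> l2norm (A x) \<le> C * l2norm x"
    using assms unfolding bounded_op_def by blast
  have "l2norm (A x) \<le> max C 0 * l2norm x" if "x \<in> l2" for x
    using C that mult_right_mono[OF _ l2norm_nonneg[OF that], of C "max C 0"] by fastforce
  then show ?thesis using C by (intro exI[of _ "max C 0"]) auto
qed

lemma bounded_op_l2: "bounded_op A \<Longrightarrow> x \<in> l2 \<Longrightarrow> A x \<in> l2"
  unfolding bounded_op_def by blast

lemma bounded_op_comp:
  assumes "bounded_op A" "bounded_op B"
  shows "bounded_op (\<lambda>x. A (B x))"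
proof -
  obtain C where C: "C \<ge> 0" "\<And>x. x \<in> l2 \<Longrightarrow> A x \<in> l2" "\<And>x. x \<in> l2 \<Longrightarrow> l2norm (A x) \<le> C * l2norm x"
    using bounded_opD[OF assms(1)] by auto
  obtain D where D: "D \<ge> 0" "\<And>x. x \<in> l2 \<Longrightarrow> B x \<in> l2" "\<And>x. x \<in> l2 \<Longrightarrow> l2norm (B x) \<le> D * l2norm x"
    using bounded_opD[OF assms(2)] by auto
  have "l2norm (A (B x)) \<le> (C * D) * l2norm x" if "x \<in> l2" for x
    using C(3)[OF D(2)[OF that]] mult_left_mono[OF D(3)[OF that] C(1)] by (simp add: mult.assoc)
  then show ?thesis by (intro bounded_opI[where C = "C * D"] C(2) D(2)) auto
qed

lemma bounded_op_add:
  assumes "bounded_op A" "bounded_op B"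
  shows "bounded_op (\<lambda>x n. A x n + B x n)"
proof -
  obtain C where C: "C \<ge> 0" "\<And>x. x \<in> l2 \<Longrightarrow> A x \<in> l2" "\<And>x. x \<in> l2 \<Longrightarrow> l2norm (A x) \<le> C * l2norm x"
    using bounded_opD[OF assms(1)] by auto
  obtain D where D: "D \<ge> 0" "\<And>x. x \<in> l2 \<Longrightarrow> B x \<in> l2" "\<And>x. x \<in> l2 \<Longrightarrow> l2norm (B x) \<le> D * l2norm x"
    using bounded_opD[OF assms(2)] by auto
  have "l2norm (\<lambda>n. A x n + B x n) \<le> (C + D) * l2norm x" if "x \<in> l2" for x
    using l2_add(2)[OF C(2)[OF that] D(2)[OF that]] C(3)[OF that] D(3)[OF that]
    by (simp add: distrib_right)
  then show ?thesis by (intro bounded_opI[where C = "C + D"] l2_add(1) C(2) D(2)) auto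
qed

lemma bounded_op_scale:
  assumes "bounded_op A"
  shows "bounded_op (\<lambda>x n. c * A x n)"
proof -
  have "bounded_op (\<lambda>x n. c * x n)"
    using l2_scale by (intro bounded_opI[where C = "cmod c"]) auto
  from bounded_op_comp[OF this assms] show ?thesis .
qed

lemma bounded_op_diff:
  assumes "bounded_op A" "bounded_op B"
  shows "bounded_op (\<lambda>x n. A x n - B x n)"
  using bounded_op_add[OF assms(1) bounded_op_scale[OF assms(2), of "-1"]] by simp

lemma bounded_op_zero: "bounded_op (\<lambda>x n. 0)"
  by (rule bounded_opI[where C = 0]) auto

lemma bounded_op_sum:
  assumes "finite I" "\<And>i. i \<in> I \<Longrightarrow> bounded_op (A i)"
  shows "bounded_op (\<lambda>x n. \<Sum>i\<in>I. A i x n)"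
  using assms by (induction I) (auto intro: bounded_op_zero bounded_op_add)

lemma bounded_op_lshift: "bounded_op A \<Longrightarrow> bounded_op (\<lambda>x. lshift (A x))"
  by (rule bounded_op_comp[of lshift], rule bounded_opI[where C = 1]) (auto intro: l2_lshift)

lemma bounded_op_rshift: "bounded_op A \<Longrightarrow> bounded_op (\<lambda>x. rshift (A x))"
  by (rule bounded_op_comp[of rshift], rule bounded_opI[where C = 1]) (auto intro: l2_rshift)

lemma bounded_op_decimate:
  assumes "k \<ge> 1"
  shows "bounded_op (\<lambda>x m. x (m * k + i))"
proof -
  have "L2_set (\<lambda>m. cmod (x (m * k + i))) {..<N} \<le> l2norm x" if "x \<in> l2" for x N
  proof -
    have inj: "inj_on (\<lambda>m. m * k + i) {..<N}" using assms by (auto simp: inj_on_def)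
    have "(\<Sum>m<N. (cmod (x (m * k + i)))\<^sup>2) = (\<Sum>j\<in>(\<lambda>m. m * k + i) ` {..<N}. (cmod (x j))\<^sup>2)"
      by (simp add: sum.reindex[OF inj])
    also have "\<dots> \<le> (\<Sum>j<N * k + i. (cmod (x j))\<^sup>2)"
      using assms by (intro sum_mono2) auto
    finally have "L2_set (\<lambda>m. cmod (x (m * k + i))) {..<N} \<le> L2_set (\<lambda>j. cmod (x j)) {..<N * k + i}"
      unfolding L2_set_def by simp
    then show ?thesis using L2_set_le_l2norm[OF that] order.trans by blast
  qed
  from l2_boundedI[OF this] show ?thesis by (intro bounded_opI[where C = 1]) auto
qed

lemma bounded_op_spread:
  assumes "k \<ge> 1"
  shows "bounded_op (\<lambda>x j. if j mod k = i then x (j div k) else 0)"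
proof -
  have "L2_set (\<lambda>j. cmod (if j mod k = i then x (j div k) else 0)) {..<N} \<le> l2norm x" if "x \<in> l2" for x N
  proof -
    let ?J = "{j\<in>{..<N}. j mod k = i}"
    have inj: "inj_on (\<lambda>j. j div k) ?J"
      by (auto simp: inj_on_def) (metis div_mod_decomp)
    have "(\<Sum>j<N. (cmod (if j mod k = i then x (j div k) else 0))\<^sup>2) = (\<Sum>j\<in>?J. (cmod (x (j div k)))\<^sup>2)"
      by (subst sum.inter_filter) (auto intro: sum.cong)
    also have "\<dots> = (\<Sum>m\<in>(\<lambda>j. j div k) ` ?J. (cmod (x m))\<^sup>2)"
      by (simp only: sum.reindex[OF inj] o_def)
    also have "\<dots> \<le> (\<Sum>m<N. (cmod (x m))\<^sup>2)"
      using assms by (intro sum_mono2) (auto intro: le_less_trans[OF div_le_dividend])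
    finally have "L2_set (\<lambda>j. cmod (if j mod k = i then x (j div k) else 0)) {..<N} \<le> L2_set (\<lambda>j. cmod (x j)) {..<N}"
      unfolding L2_set_def by simp
    then show ?thesis using L2_set_le_l2norm[OF that] order.trans by blast
  qed
  from l2_boundedI[OF this] show ?thesis by (intro bounded_opI[where C = 1]) auto
qed

lemma sum_select_mod:
  assumes "k \<ge> (1::nat)"
  shows "(\<Sum>i<k. if j mod k = i then f i else 0) = f (j mod k)"
  using assms by simp

lemma bounded_op_interleave:
  assumes "k \<ge> 1" "\<And>i. i < k \<Longrightarrow> bounded_op (A i)"
  shows "bounded_op (\<lambda>x j. A (j mod k) x (j div k))"
proof -
  have "bounded_op (\<lambda>x j. \<Sum>i\<in>{..<k}. if j mod k = i then A i x (j div k) else 0)"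
    using bounded_op_comp[OF bounded_op_spread[OF assms(1)] assms(2)]
    by (intro bounded_op_sum) auto
  then show ?thesis by (simp only: sum_select_mod[OF assms(1)])
qed

lemma interleave_l2:
  assumes "k \<ge> 1" "\<And>i. i < k \<Longrightarrow> X i \<in> l2"
  shows "(\<lambda>j. X (j mod k) (j div k)) \<in> l2"
proof -
  have "(\<lambda>j. \<Sum>i\<in>I. if j mod k = i then X i (j div k) else 0) \<in> l2" if "finite I" "I \<subseteq> {..<k}" for I
    using that
  proof (induction I)
    case (insert i I)
    then have "(\<lambda>j. if j mod k = i then X i (j div k) else 0) \<in> l2"
      using bounded_op_l2[OF bounded_op_spread[OF assms(1)], of "X i" i] assms(2) by simp
    from l2_add(1)[OF this insert.IH] insert show ?case by (simp del: sum.delta sum.delta')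
  qed simp
  from this[of "{..<k}"] show ?thesis by (simp only: sum_select_mod[OF assms(1)] finite_lessThan order.refl)
qed

lemma rshift_resolvent_estimate:
  assumes s: "cmod s < 1" and x: "x \<in> l2" and y: "\<And>n. y n = x n + s * rshift y n"
  shows "y \<in> l2" "l2norm y \<le> 1 / (1 - cmod s) * l2norm x"
proof -
  have "L2_set (\<lambda>n. cmod (y n)) {..<N} \<le> 1 / (1 - cmod s) * l2norm x" for N
  proof -
    have "L2_set (\<lambda>n. cmod (y n)) {..<N} = L2_set (\<lambda>n. cmod (x n + s * rshift y n)) {..<N}"
      by (rule L2_set_cong[OF refl]) (simp only: y[symmetric])
    also have "\<dots> \<le> L2_set (\<lambda>n. cmod (x n)) {..<N} + cmod s * L2_set (\<lambda>n. cmod (rshift y n)) {..<N}"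
      using L2_set_cmod_add_le[of x "\<lambda>n. s * rshift y n"] by (simp add: L2_set_cmod_scale)
    also have "\<dots> \<le> l2norm x + cmod s * L2_set (\<lambda>n. cmod (y n)) {..<N}"
      by (intro add_mono mult_left_mono L2_set_le_l2norm[OF x] L2_set_rshift_le) auto
    finally have "(1 - cmod s) * L2_set (\<lambda>n. cmod (y n)) {..<N} \<le> l2norm x"
      by (simp add: algebra_simps)
    then show ?thesis using s by (simp add: field_simps)
  qed
  then show "y \<in> l2" "l2norm y \<le> 1 / (1 - cmod s) * l2norm x" using l2_boundedI by blast+
qed

lemma lshift_resolvent_estimate:
  assumes r: "cmod r < 1" and x: "x \<in> l2" and y: "\<And>n. y n = x n + r * lshift y n"
    and M: "\<And>n. cmod (y n) \<le> M"
  shows "y \<in> l2" "l2norm y \<le> 1 / (1 - cmod r) * l2norm x"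
proof -
  have step: "L2_set (\<lambda>n. cmod (y n)) {..<N} \<le> l2norm x + cmod r * L2_set (\<lambda>n. cmod (lshift y n)) {..<N}" for N
  proof -
    have "L2_set (\<lambda>n. cmod (y n)) {..<N} = L2_set (\<lambda>n. cmod (x n + r * lshift y n)) {..<N}"
      by (rule L2_set_cong[OF refl]) (simp only: y[symmetric])
    also have "\<dots> \<le> L2_set (\<lambda>n. cmod (x n)) {..<N} + cmod r * L2_set (\<lambda>n. cmod (lshift y n)) {..<N}"
      using L2_set_cmod_add_le[of x "\<lambda>n. r * lshift y n"] by (simp add: L2_set_cmod_scale)
    also have "\<dots> \<le> l2norm x + cmod r * L2_set (\<lambda>n. cmod (lshift y n)) {..<N}"
      using L2_set_le_l2norm[OF x] by simp
    finally show ?thesis .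
  qed
  have "L2_set (\<lambda>n. cmod (y n)) {..<N} \<le> (l2norm x + cmod r * M) / (1 - cmod r)" for N
  proof -
    have "L2_set (\<lambda>n. cmod (y n)) {..<Suc N} = sqrt ((cmod (y N))\<^sup>2 + (L2_set (\<lambda>n. cmod (y n)) {..<N})\<^sup>2)"
      by (simp add: lessThan_Suc)
    also have "\<dots> \<le> cmod (y N) + L2_set (\<lambda>n. cmod (y n)) {..<N}"
      by (rule sqrt_sum_squares_le_sum) auto
    also have "\<dots> \<le> M + L2_set (\<lambda>n. cmod (y n)) {..<N}" using M by simp
    finally have "L2_set (\<lambda>n. cmod (lshift y n)) {..<N} \<le> M + L2_set (\<lambda>n. cmod (y n)) {..<N}"
      using L2_set_lshift_le order.trans by blast
    from mult_left_mono[OF this norm_ge_zero[of r]]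
    have "L2_set (\<lambda>n. cmod (y n)) {..<N} \<le> l2norm x + cmod r * (M + L2_set (\<lambda>n. cmod (y n)) {..<N})"
      using step[of N] by linarith
    then have "(1 - cmod r) * L2_set (\<lambda>n. cmod (y n)) {..<N} \<le> l2norm x + cmod r * M"
      by (simp add: algebra_simps)
    then show ?thesis using r by (simp add: field_simps)
  qed
  then show y2: "y \<in> l2" using l2_boundedI by blast
  have "l2norm y \<le> l2norm x + cmod r * l2norm y"
  proof (rule l2_boundedI(2))
    fix N
    have "L2_set (\<lambda>n. cmod (lshift y n)) {..<N} \<le> l2norm y"
      using L2_set_lshift_le L2_set_le_l2norm[OF y2] order.trans by blast
    from mult_left_mono[OF this norm_ge_zero[of r]]
    show "L2_set (\<lambda>n. cmod (y n)) {..<N} \<le> l2norm x + cmod r * l2norm y"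
      using step[of N] by linarith
  qed
  then have "(1 - cmod r) * l2norm y \<le> l2norm x" by (simp add: algebra_simps)
  then show "l2norm y \<le> 1 / (1 - cmod r) * l2norm x" using r by (simp add: field_simps)
qed

primrec rshift_resolvent :: "complex \<Rightarrow> (nat \<Rightarrow> complex) \<Rightarrow> nat \<Rightarrow> complex" where
  "rshift_resolvent s x 0 = x 0"
| "rshift_resolvent s x (Suc n) = x (Suc n) + s * rshift_resolvent s x n"

lemma rshift_resolvent_eq: "rshift_resolvent s x n = x n + s * rshift (rshift_resolvent s x) n"
  by (cases n) (auto simp: rshift_def)

lemma bounded_op_rshift_resolvent:
  assumes "cmod s < 1"
  shows "bounded_op (rshift_resolvent s)"
  by (rule bounded_opI) (rule rshift_resolvent_estimate[OF assms _ rshift_resolvent_eq]; assumption)+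

definition lshift_resolvent :: "complex \<Rightarrow> (nat \<Rightarrow> complex) \<Rightarrow> nat \<Rightarrow> complex" where
  "lshift_resolvent r x n = (\<Sum>m. r ^ m * x (n + m))"

lemma
  assumes r: "cmod r < 1" and x: "x \<in> l2"
  shows lshift_resolvent_eq: "lshift_resolvent r x n = x n + r * lshift (lshift_resolvent r x) n"
    and lshift_resolvent_bounded: "cmod (lshift_resolvent r x n) \<le> l2norm x / (1 - cmod r)"
proof -
  have sg: "summable (\<lambda>m. cmod r ^ m * l2norm x)"
    using r by (intro summable_mult2 summable_geometric) auto
  have le: "cmod (r ^ m * x (n + m)) \<le> cmod r ^ m * l2norm x" for n m
    using cmod_le_l2norm[OF x, of "n + m"] by (simp add: norm_mult norm_power mult_left_mono)
  have sn: "summable (\<lambda>m. cmod (r ^ m * x (n + m)))" for n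
    by (rule summable_comparison_test'[OF sg, of 0]) (simp only: real_norm_def abs_norm_cancel le)
  have s: "summable (\<lambda>m. r ^ m * x (n + m))" for n
    by (rule summable_norm_cancel[OF sn])
  have "lshift_resolvent r x n = x n + (\<Sum>m. r ^ Suc m * x (n + Suc m))"
    unfolding lshift_resolvent_def using suminf_split_head[OF s[of n]] by simp
  also have "(\<Sum>m. r ^ Suc m * x (n + Suc m)) = r * lshift (lshift_resolvent r x) n"
    unfolding lshift_resolvent_def lshift_def using suminf_mult[OF s[of "Suc n"], of r]
    by (simp add: mult.assoc)
  finally show "lshift_resolvent r x n = x n + r * lshift (lshift_resolvent r x) n" .
  have "cmod (lshift_resolvent r x n) \<le> (\<Sum>m. cmod (r ^ m * x (n + m)))"
    unfolding lshift_resolvent_def by (rule summable_norm[OF sn])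
  also have "\<dots> \<le> (\<Sum>m. cmod r ^ m * l2norm x)"
    by (rule suminf_le[OF le sn sg])
  also have "\<dots> = l2norm x / (1 - cmod r)"
    using suminf_mult2[of "\<lambda>m. cmod r ^ m" "l2norm x"] suminf_geometric[of "cmod r"] r
      summable_geometric[of "cmod r"] by simp
  finally show "cmod (lshift_resolvent r x n) \<le> l2norm x / (1 - cmod r)" .
qed

lemma bounded_op_lshift_resolvent:
  assumes "cmod r < 1"
  shows "bounded_op (lshift_resolvent r)"
  by (rule bounded_opI)
    (rule lshift_resolvent_estimate[OF assms _ lshift_resolvent_eq[OF assms] lshift_resolvent_bounded[OF assms]]; assumption)+

text \<open>The Wiener--Hopf factorization \<open>C (1 - r L) (1 - s R)\<close> of a tridiagonal Toeplitz operator.\<close>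

lemma scalar_toeplitz_inverse:
  assumes C: "C \<noteq> 0" and r: "cmod r < 1" and s: "cmod s < 1" and y: "y \<in> l2"
  defines "x \<equiv> rshift_resolvent s (lshift_resolvent r (\<lambda>n. inverse C * y n))"
  shows "C * (1 + r * s) * x n - C * r * lshift x n - C * s * rshift x n = y n"
proof -
  define u where "u = lshift_resolvent r (\<lambda>n. inverse C * y n)"
  have u: "u n = inverse C * y n + r * u (Suc n)" for n
    using lshift_resolvent_eq[OF r l2_scale(1)[OF y, of "inverse C"], of n]
    unfolding u_def[symmetric] lshift_def .
  have x: "u n = x n - s * rshift x n" for n
    using rshift_resolvent_eq[of s u n] unfolding x_def u_def[symmetric] by simp
  have "C * (u n - r * u (Suc n)) = y n" using u[of n] C by simp
  then show ?thesis unfolding x by (simp add: lshift_def rshift_def algebra_simps split: if_splits)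
qed

lemma scalar_toeplitz_injective:
  assumes C: "C \<noteq> 0" and r: "cmod r < 1" and s: "cmod s < 1" and x: "x \<in> l2"
    and 0: "\<And>n. C * (1 + r * s) * x n - C * r * lshift x n - C * s * rshift x n = 0"
  shows "x n = 0"
proof -
  define u where "u = (\<lambda>n. x n + (-s) * rshift x n)"
  have u2: "u \<in> l2" unfolding u_def by (intro l2_add l2_scale l2_rshift x)
  have u: "u n = 0 + r * lshift u n" for n
  proof -
    have "C * (u n - r * lshift u n) = 0"
      using 0[of n] by (simp add: u_def lshift_def rshift_def algebra_simps split: if_splits)
    then show ?thesis using C by simp
  qed
  have "l2norm u \<le> 0"
    using lshift_resolvent_estimate(2)[OF r zero_l2 u, of "l2norm u"] cmod_le_l2norm[OF u2] by simp
  then have u0: "u n = 0" for n using l2norm_le_0_imp[OF u2] by blast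
  have xe: "x n = 0 + s * rshift x n" for n using u0[of n] by (simp add: u_def)
  have "l2norm x \<le> 0"
    using rshift_resolvent_estimate(2)[OF s zero_l2 xe] by simp
  then show ?thesis using l2norm_le_0_imp[OF x] by blast
qed

section \<open>Winding numbers of quadratics on the unit circle\<close>

lemma winding_number_mult:
  assumes p: "path p" "0 \<notin> path_image p" and q: "path q" "0 \<notin> path_image q"
  shows "winding_number (\<lambda>t. p t * q t) 0 = winding_number p 0 + winding_number q 0"
proof -
  obtain u where u: "path u" "pathfinish u - pathstart u = 2 * of_real pi * \<i> * winding_number p 0"
    "\<And>t. t \<in> {0..1} \<Longrightarrow> p t = 0 + exp (u t)"
    using winding_number_as_continuous_log[OF p] by blast
  obtain v where v: "path v" "pathfinish v - pathstart v = 2 * of_real pi * \<i> * winding_number q 0"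
    "\<And>t. t \<in> {0..1} \<Longrightarrow> q t = 0 + exp (v t)"
    using winding_number_as_continuous_log[OF q] by blast
  have uv: "path (\<lambda>t. u t + v t)"
    using u(1) v(1) unfolding path_def by (intro continuous_intros)
  have "winding_number (\<lambda>t. p t * q t) 0 = winding_number (exp \<circ> (\<lambda>t. u t + v t)) 0"
    by (rule winding_number_cong) (auto simp: u(3) v(3) exp_add)
  also have "\<dots> = ((pathfinish u - pathstart u) + (pathfinish v - pathstart v)) / (2 * of_real pi * \<i>)"
    by (simp add: winding_number_compose_exp[OF uv] pathfinish_def pathstart_def)
  also have "\<dots> = winding_number p 0 + winding_number q 0"
    unfolding u(2) v(2) by (simp add: field_simps)
  finally show ?thesis .
qed

lemma circlepath_eq_cis: "circlepath 0 1 t = cis (2 * pi * t)"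
  by (simp add: circlepath_def part_circlepath_def linepath_def cis_conv_exp scaleR_conv_of_real mult_ac)

lemma path_cis: "path (\<lambda>t. cis (2 * pi * t))"
  unfolding path_def by (intro continuous_intros)

lemma winding_number_cis_minus:
  assumes "cmod r < 1"
  shows "winding_number (\<lambda>t. cis (2 * pi * t) - r) 0 = 1"
proof -
  have "winding_number (\<lambda>t. cis (2 * pi * t) - r) 0 = winding_number (circlepath 0 1) r"
    by (subst winding_number_offset) (simp add: circlepath_eq_cis)
  then show ?thesis using assms by (simp add: winding_number_circlepath)
qed

lemma winding_number_one_minus_cis:
  assumes "cmod s < 1"
  shows "winding_number (\<lambda>t. 1 - s * cis (2 * pi * t)) 0 = 0"
proof (rule winding_number_zero_outside)
  show "path (\<lambda>t. 1 - s * cis (2 * pi * t))"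
    unfolding path_def by (intro continuous_intros)
  show "convex (ball (1::complex) 1)" by simp
  show "path_image (\<lambda>t. 1 - s * cis (2 * pi * t)) \<subseteq> ball 1 1"
    using assms by (auto simp: path_image_def dist_norm norm_mult)
qed (auto simp: pathfinish_def pathstart_def)

lemma winding_number_inverse_cis: "winding_number (\<lambda>t. inverse (cis (2 * pi * t))) 0 = -1"
proof -
  have "winding_number (\<lambda>t. cis (2 * pi * t) * inverse (cis (2 * pi * t))) 0
      = winding_number (\<lambda>t. cis (2 * pi * t)) 0 + winding_number (\<lambda>t. inverse (cis (2 * pi * t))) 0"
    by (rule winding_number_mult[OF path_cis])
       (auto simp: path_def path_image_def intro!: continuous_intros)
  moreover have "winding_number (\<lambda>t. cis (2 * pi * t) * inverse (cis (2 * pi * t))) 0 = 0"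
    by (simp add: winding_number_zero_const cis_mult)
  ultimately show ?thesis using winding_number_cis_minus[of 0] by (simp add: add_eq_0_iff)
qed

lemma winding_number_quadratic_over_cis:
  assumes C: "C \<noteq> 0" and p: "path p" "\<And>t. t \<in> {0..1} \<Longrightarrow> p t \<noteq> 0" and q: "path q" "\<And>t. t \<in> {0..1} \<Longrightarrow> q t \<noteq> 0"
  shows "winding_number (\<lambda>t. C * p t * q t * inverse (cis (2 * pi * t))) 0
     = winding_number p 0 + winding_number q 0 - 1"
proof -
  have c: "path (\<lambda>t::real. C)" by (simp add: path_def)
  have i: "path (\<lambda>t. inverse (cis (2 * pi * t)))" by (auto simp: path_def intro!: continuous_intros)
  have p0: "0 \<notin> path_image p" and q0: "0 \<notin> path_image q" using p q by (auto simp: path_image_def)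
  have cp: "path (\<lambda>t. C * p t)" and cpq: "path (\<lambda>t. C * p t * q t)"
    using p q unfolding path_def by (auto intro!: continuous_intros)
  have "winding_number (\<lambda>t. C * p t * q t * inverse (cis (2 * pi * t))) 0
     = winding_number (\<lambda>t. C * p t * q t) 0 + (-1)"
    unfolding winding_number_inverse_cis[symmetric]
    by (rule winding_number_mult[OF cpq _ i]) (use C p q in \<open>auto simp: path_image_def\<close>)
  also have "winding_number (\<lambda>t. C * p t * q t) 0 = winding_number (\<lambda>t. C * p t) 0 + winding_number q 0"
    by (rule winding_number_mult[OF cp _ q(1) q0]) (use C p in \<open>auto simp: path_image_def\<close>)
  also have "winding_number (\<lambda>t. C * p t) 0 = winding_number (\<lambda>t::real. C) 0 + winding_number p 0"
    by (rule winding_number_mult[OF c _ p(1) p0]) (use C in \<open>auto simp: path_image_def\<close>)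
  also have "winding_number (\<lambda>t::real. C) 0 = 0" using C by (rule winding_number_zero_const)
  finally show ?thesis by simp
qed

lemma quadratic_factors:
  assumes "\<gamma> \<noteq> (0::complex)"
  obtains r1 r2 where "\<alpha> = - \<gamma> * (r1 + r2)" "\<beta> = \<gamma> * r1 * r2"
proof -
  define d where "d = csqrt (\<alpha>\<^sup>2 - 4 * \<gamma> * \<beta>)"
  have d: "d\<^sup>2 = \<alpha>\<^sup>2 - 4 * \<gamma> * \<beta>" by (simp add: d_def)
  have "\<gamma> * ((-\<alpha> + d) / (2 * \<gamma>)) * ((-\<alpha> - d) / (2 * \<gamma>)) = (\<alpha>\<^sup>2 - d\<^sup>2) / (4 * \<gamma>)"
    using assms by (simp add: field_simps power2_eq_square)
  also have "\<dots> = \<beta>" using assms by (simp add: d)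
  finally show ?thesis
    using that[of "(-\<alpha> + d) / (2 * \<gamma>)" "(-\<alpha> - d) / (2 * \<gamma>)"] assms by (simp add: field_simps)
qed

lemma norm_inverse_less_1: "cmod r > 1 \<Longrightarrow> cmod (1 / r) < 1"
  by (simp add: norm_divide divide_less_eq)

text \<open>The three cases are the factorizations \<open>C (1 - s\<^sub>1 z) (1 - s\<^sub>2 z)\<close>, \<open>C (z - r) (1 - s z)\<close> and
  \<open>C (z - r\<^sub>1) (z - r\<^sub>2)\<close> of \<open>\<beta> + \<alpha> z + \<gamma> z\<^sup>2\<close>, according to the number of zeros in the unit disk.\<close>

lemma quadratic_trichotomy:
  fixes \<alpha> \<beta> \<gamma> :: complex
  assumes nz: "\<And>z. cmod z = 1 \<Longrightarrow> \<beta> + \<alpha> * z + \<gamma> * z\<^sup>2 \<noteq> 0"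
  obtains
    (outside) C s1 s2 where "C \<noteq> 0" "cmod s1 < 1" "cmod s2 < 1"
      "\<beta> = C" "\<alpha> = - C * (s1 + s2)" "\<gamma> = C * s1 * s2"
  | (mixed) C r s where "C \<noteq> 0" "cmod r < 1" "cmod s < 1"
      "\<beta> = - C * r" "\<alpha> = C * (1 + r * s)" "\<gamma> = - C * s"
  | (inside) C r1 r2 where "C \<noteq> 0" "cmod r1 < 1" "cmod r2 < 1"
      "\<beta> = C * r1 * r2" "\<alpha> = - C * (r1 + r2)" "\<gamma> = C"
proof (cases "\<gamma> = 0")
  case True
  show ?thesis
  proof (cases "\<alpha> = 0")
    case a0: True
    have "\<beta> \<noteq> 0" using nz[of 1] True a0 by auto
    then show ?thesis using outside[of \<beta> 0 0] True a0 by auto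
  next
    case a: False
    define r where "r = - \<beta> / \<alpha>"
    have br: "\<beta> = - \<alpha> * r" using a by (simp add: r_def)
    have "cmod r \<noteq> 1" using nz[of r] True br by auto
    then consider "cmod r < 1" | "cmod r > 1" by linarith
    then show ?thesis
    proof cases
      case 1
      then show ?thesis using mixed[of \<alpha> r 0] True a br by auto
    next
      case 2
      then have r0: "r \<noteq> 0" by auto
      show ?thesis
      proof (rule outside[of \<beta> "1 / r" 0])
        show "\<alpha> = - \<beta> * (1 / r + 0)" "\<beta> \<noteq> 0" unfolding br using a r0 by auto
      qed (use True norm_inverse_less_1[OF 2] in auto)
    qed
  qed
next
  case g: False
  obtain r1 r2 where r: "\<alpha> = - \<gamma> * (r1 + r2)" "\<beta> = \<gamma> * r1 * r2"
    using quadratic_factors[OF g] by blast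
  have fac: "\<beta> + \<alpha> * z + \<gamma> * z\<^sup>2 = \<gamma> * (z - r1) * (z - r2)" for z
    unfolding r by (simp add: algebra_simps power2_eq_square)
  have n1: "cmod r1 \<noteq> 1" "cmod r2 \<noteq> 1" using nz[of r1] nz[of r2] unfolding fac by auto
  have mix: ?thesis if "cmod p < 1" "cmod q > 1" "\<alpha> = - \<gamma> * (p + q)" "\<beta> = \<gamma> * p * q" for p q
  proof -
    have q: "q \<noteq> 0" using that(2) by auto
    show ?thesis
    proof (rule mixed[of "- \<gamma> * q" p "1 / q"])
      show "\<alpha> = - \<gamma> * q * (1 + p * (1 / q))" "\<gamma> = - (- \<gamma> * q) * (1 / q)" "\<beta> = - (- \<gamma> * q) * p"
        unfolding that(3,4) using q by (simp_all add: algebra_simps)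
    qed (use q g that norm_inverse_less_1 in auto)
  qed
  consider "cmod r1 < 1" "cmod r2 < 1" | "cmod r1 < 1" "cmod r2 > 1" | "cmod r2 < 1" "cmod r1 > 1"
    | "cmod r1 > 1" "cmod r2 > 1" using n1 by linarith
  then show ?thesis
  proof cases
    case 1
    then show ?thesis using inside[of \<gamma> r1 r2] g r by auto
  next
    case 2
    then show ?thesis using mix[of r1 r2] r by auto
  next
    case 3
    then show ?thesis using mix[of r2 r1] r by (simp add: mult_ac add_ac)
  next
    case 4
    then have q: "r1 \<noteq> 0" "r2 \<noteq> 0" by auto
    show ?thesis
    proof (rule outside[of \<beta> "1 / r1" "1 / r2"])
      show "\<alpha> = - \<beta> * (1 / r1 + 1 / r2)" "\<gamma> = \<beta> * (1 / r1) * (1 / r2)" "\<beta> \<noteq> 0"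
        unfolding r using q g by (simp_all add: field_simps)
    qed (use 4 norm_inverse_less_1 in auto)
  qed
qed

lemma winding_number_outside:
  assumes "C \<noteq> 0" "cmod s1 < 1" "cmod s2 < 1"
  shows "winding_number (\<lambda>t. C * (1 - s1 * cis (2 * pi * t)) * (1 - s2 * cis (2 * pi * t))
            * inverse (cis (2 * pi * t))) 0 = -1"
proof -
  have nz: "1 - s * cis u \<noteq> 0" if "cmod s < 1" for s u
    using that by (metis eq_iff_diff_eq_0 less_irrefl mult.right_neutral norm_cis norm_mult norm_one)
  show ?thesis
    by (subst winding_number_quadratic_over_cis[OF assms(1)])
       (use assms nz in \<open>auto simp: winding_number_one_minus_cis path_def intro!: continuous_intros\<close>)
qed

lemma winding_number_mixed:
  assumes "C \<noteq> 0" "cmod r < 1" "cmod s < 1"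
  shows "winding_number (\<lambda>t. C * (cis (2 * pi * t) - r) * (1 - s * cis (2 * pi * t))
            * inverse (cis (2 * pi * t))) 0 = 0"
proof -
  have nz: "1 - s * cis u \<noteq> 0" for u
    using assms(3) by (metis eq_iff_diff_eq_0 less_irrefl mult.right_neutral norm_cis norm_mult norm_one)
  have nz': "cis u - r \<noteq> 0" for u using assms(2) by (metis eq_iff_diff_eq_0 less_irrefl norm_cis)
  show ?thesis
    by (subst winding_number_quadratic_over_cis[OF assms(1)])
       (use assms nz nz' in \<open>auto simp: winding_number_one_minus_cis winding_number_cis_minus path_def intro!: continuous_intros\<close>)
qed

lemma winding_number_inside:
  assumes "C \<noteq> 0" "cmod r1 < 1" "cmod r2 < 1"
  shows "winding_number (\<lambda>t. C * (cis (2 * pi * t) - r1) * (cis (2 * pi * t) - r2)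
            * inverse (cis (2 * pi * t))) 0 = 1"
proof -
  have nz: "cis u - r \<noteq> 0" if "cmod r < 1" for u r using that by (metis eq_iff_diff_eq_0 less_irrefl norm_cis)
  show ?thesis
    by (subst winding_number_quadratic_over_cis[OF assms(1)])
       (use assms nz in \<open>auto simp: winding_number_cis_minus path_def intro!: continuous_intros\<close>)
qed

section \<open>The Toeplitz operator in blocks\<close>

lemma symbol_matrix_carrier [simp]:
  "A0 k a b c \<in> carrier_mat k k" "Am1 k b \<in> carrier_mat k k" "Ap1 k c \<in> carrier_mat k k"
  "symb k a b c z \<in> carrier_mat k k"
  by (auto simp: A0_def Am1_def Ap1_def symb_def)

lemma symb_minus_index:
  assumes "i < k" "j < k"
  shows "(symb k a b c z - mu \<cdot>\<^sub>m 1\<^sub>m k) $$ (i, j)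
     = inverse z * Am1 k b $$ (i, j) + A0 k a b c $$ (i, j) + z * Ap1 k c $$ (i, j) - (if i = j then mu else 0)"
  using assms by (auto simp: symb_def A0_def Am1_def Ap1_def)

lemma ktoep_block:
  assumes i: "i < k"
  shows "ktoep k a b c x (m * k + i) = (\<Sum>j<k. A0 k a b c $$ (i, j) * x (m * k + j)
      + Am1 k b $$ (i, j) * lshift (\<lambda>m. x (m * k + j)) m + Ap1 k c $$ (i, j) * rshift (\<lambda>m. x (m * k + j)) m)"
proof -
  have A0: "(\<Sum>j<k. A0 k a b c $$ (i, j) * f j)
      = a (Suc i) * f i + (if Suc i < k then b (Suc i) * f (Suc i) else 0)
        + (if i = 0 then 0 else c i * f (i - 1))" for f :: "nat \<Rightarrow> complex"
  proof -
    have "(\<Sum>j<k. A0 k a b c $$ (i, j) * f j)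
        = (\<Sum>j<k. (if j = i then a (Suc i) * f i else 0) + (if j = Suc i then b (Suc i) * f (Suc i) else 0)
            + (if j = i - 1 then (if i = 0 then 0 else c i * f (i - 1)) else 0))"
      using i by (intro sum.cong) (auto simp: A0_def)
    then show ?thesis using i by (simp add: sum.distrib)
  qed
  have Am1: "(\<Sum>j<k. Am1 k b $$ (i, j) * f j) = (if Suc i = k then b k * f 0 else 0)" for f :: "nat \<Rightarrow> complex"
  proof -
    have "(\<Sum>j<k. Am1 k b $$ (i, j) * f j) = (\<Sum>j<k. if j = 0 then (if Suc i = k then b k * f 0 else 0) else 0)"
      using i by (intro sum.cong) (auto simp: Am1_def)
    then show ?thesis using i by simp
  qed
  have Ap1: "(\<Sum>j<k. Ap1 k c $$ (i, j) * f j) = (if i = 0 then c k * f (k - 1) else 0)" for f :: "nat \<Rightarrow> complex"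
  proof -
    have "(\<Sum>j<k. Ap1 k c $$ (i, j) * f j) = (\<Sum>j<k. if j = k - 1 then (if i = 0 then c k * f (k - 1) else 0) else 0)"
      using i by (intro sum.cong) (auto simp: Ap1_def)
    then show ?thesis using i by simp
  qed
  have prev: "(m * k + i - 1) mod k = (if i = 0 then k - 1 else i - 1)" if "\<not> (m = 0 \<and> i = 0)"
  proof (cases "i = 0")
    case True
    with that obtain m' where m': "m = Suc m'" by (cases m) auto
    have "(m * k + i - 1) mod k = (m' * k + (k - 1)) mod k" using i True m' by (simp add: add.commute)
    also have "\<dots> = k - 1" unfolding mod_mult_self3 using i by simp
    finally show ?thesis using True by simp
  next
    case False
    then have "(m * k + i - 1) mod k = (m * k + (i - 1)) mod k" by simp
    also have "\<dots> = i - 1" unfolding mod_mult_self3 using i by simp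
    finally show ?thesis using False by simp
  qed
  have prev_block: "m * k - 1 = (m - 1) * k + (k - 1)" if "m \<noteq> 0"
    using that i by (cases m) auto
  have b: "b (Suc i) * x (Suc (m * k + i)) = (if Suc i < k then b (Suc i) * x (m * k + Suc i) else 0)
      + (if Suc i = k then b k * lshift (\<lambda>m. x (m * k + 0)) m else 0)"
    using i by (cases "Suc i = k") (auto simp: lshift_def add.commute)
  have c: "(if m * k + i = 0 then 0 else c (pidx k (m * k + i - 1)) * x (m * k + i - 1))
      = (if i = 0 then 0 else c i * x (m * k + (i - 1)))
        + (if i = 0 then c k * rshift (\<lambda>m. x (m * k + (k - 1))) m else 0)"
  proof (cases "m = 0 \<and> i = 0")
    case False
    show ?thesis unfolding pidx_def prev[OF False]
      using False i prev_block by (auto simp: rshift_def)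
  qed (simp add: rshift_def)
  have a: "pidx k (m * k + i) = Suc i" using i by (simp add: pidx_def)
  show ?thesis
    unfolding sum.distrib A0 Am1 Ap1 ktoep_def a b c by (simp add: algebra_simps)
qed

lemma bounded_op_ktoep:
  assumes k: "k \<ge> 1"
  shows "bounded_op (ktoep k a b c)"
proof -
  let ?D = "\<lambda>j x m. x (m * k + j) :: complex"
  define A where "A i x m = (\<Sum>j<k. A0 k a b c $$ (i, j) * ?D j x m
      + Am1 k b $$ (i, j) * lshift (?D j x) m + Ap1 k c $$ (i, j) * rshift (?D j x) m)" for i x m
  have "bounded_op (A i)" for i
    unfolding A_def
    by (intro bounded_op_sum bounded_op_add bounded_op_scale bounded_op_lshift bounded_op_rshift
        bounded_op_decimate k finite_lessThan)
  then have "bounded_op (\<lambda>x j. A (j mod k) x (j div k))"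
    by (intro bounded_op_interleave k)
  moreover have "ktoep k a b c = (\<lambda>x j. A (j mod k) x (j div k))"
  proof (intro ext)
    fix x j
    have "ktoep k a b c x (j div k * k + j mod k) = A (j mod k) x (j div k)"
      unfolding A_def by (rule ktoep_block) (use k in simp)
    then show "ktoep k a b c x j = A (j mod k) x (j div k)" by simp
  qed
  ultimately show ?thesis by simp
qed

lemma not_in_op_spectrumD:
  assumes "mu \<notin> op_spectrum T"
  shows "\<exists>S C. \<forall>x\<in>l2. S x \<in> l2 \<and> l2norm (S x) \<le> C * l2norm x
    \<and> S (\<lambda>j. T x j - mu * x j) = x \<and> (\<lambda>j. T (S x) j - mu * S x j) = x"
  using assms unfolding op_spectrum_def by blast

text \<open>Truncating the approximate eigenvector changes the residual only near the cut, so the residuals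
  stay bounded while the norms of the truncations do not.\<close>

lemma weyl_criterion:
  assumes k: "k \<ge> 1" and M: "\<And>n. cmod (X n) \<le> M" and X: "X \<notin> l2"
    and J: "\<And>j. j \<ge> J \<Longrightarrow> ktoep k a b c X j = mu * X j"
  shows "mu \<in> op_spectrum (ktoep k a b c)"
proof (rule ccontr)
  assume "mu \<notin> op_spectrum (ktoep k a b c)"
  from not_in_op_spectrumD[OF this]
  obtain S C where C: "\<And>x. x \<in> l2 \<Longrightarrow> l2norm (S x) \<le> C * l2norm x"
    and S: "\<And>x. x \<in> l2 \<Longrightarrow> S (\<lambda>j. ktoep k a b c x j - mu * x j) = x"
    by auto
  define B where "B f = (\<Sum>i\<in>{1..k}. cmod (f i))" for f :: "nat \<Rightarrow> complex"
  have B: "cmod (f (pidx k j)) \<le> B f" for f j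
    unfolding B_def using k by (intro member_le_sum) (auto simp: pidx_def Suc_le_eq)
  have M0: "M \<ge> 0" using M[of 0] norm_ge_zero order.trans by blast
  have B0: "B f \<ge> 0" for f unfolding B_def by (simp add: sum_nonneg)
  define K where "K = (B a + B b + B c + cmod mu) * M"
  define x where "x n j = (if j < n then X j else 0)" for n j
  define y where "y n j = ktoep k a b c (x n) j - mu * x n j" for n j
  have xM: "cmod (x n j) \<le> M" for n j using M M0 by (simp add: x_def)
  have yK: "cmod (y n j) \<le> K" for n j
  proof -
    have t: "cmod (u * x n i) \<le> v * M" if "cmod u \<le> v" for u v i
      unfolding norm_mult using that xM by (intro mult_mono) (auto intro: order.trans[OF norm_ge_zero])
    have tri: "cmod (p + q + r - s) \<le> cmod p + cmod q + cmod r + cmod s" for p q r s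
      using norm_triangle_ineq4[of "p + q + r" s] norm_triangle_ineq[of "p + q" r]
        norm_triangle_ineq[of p q] by linarith
    have "cmod (y n j) \<le> cmod (a (pidx k j) * x n j) + cmod (b (pidx k j) * x n (Suc j))
        + cmod (if j = 0 then 0 else c (pidx k (j - 1)) * x n (j - 1)) + cmod (mu * x n j)"
      unfolding y_def ktoep_def by (rule tri)
    also have "\<dots> \<le> B a * M + B b * M + B c * M + cmod mu * M"
      using t[OF B] t[of mu "cmod mu"] B0[of c] M0 by (intro add_mono) auto
    finally show ?thesis by (simp add: K_def algebra_simps)
  qed
  have supp: "y n j = 0" if "j \<notin> {..<J} \<union> {n - 1, n}" for n j
  proof (cases "Suc j < n")
    case True
    then have "y n j = ktoep k a b c X j - mu * X j" by (auto simp: y_def ktoep_def x_def)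
    then show ?thesis using J[of j] that by simp
  next
    case False
    then have "n < j" using that by auto
    then show ?thesis by (auto simp: y_def ktoep_def x_def)
  qed
  have card: "card ({..<J} \<union> {n - 1, n}) \<le> J + 2" for n
    by (rule order.trans[OF card_Un_le]) (auto simp: card_insert_if)
  have K0: "K \<ge> 0" using yK[of 0 0] norm_ge_zero order.trans by blast
  have ynorm: "y n \<in> l2" "l2norm (y n) \<le> real (J + 2) * K" for n
  proof -
    have fin: "finite ({..<J} \<union> {n - 1, n})" by simp
    note fs = finite_support_l2[OF fin supp yK]
    show "y n \<in> l2" by (rule fs(1))
    have "l2norm (y n) \<le> card ({..<J} \<union> {n - 1, n}) * K" by (rule fs(2))
    also have "\<dots> \<le> real (J + 2) * K" by (intro mult_right_mono K0 of_nat_mono card)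
    finally show "l2norm (y n) \<le> real (J + 2) * K" .
  qed
  have x2: "x n \<in> l2" for n
    by (rule finite_support_l2(1)[of "{..<n}" _ M]) (use xM in \<open>auto simp: x_def\<close>)
  have "L2_set (\<lambda>j. cmod (X j)) {..<n} \<le> \<bar>C\<bar> * (real (J + 2) * K)" for n
  proof -
    have "L2_set (\<lambda>j. cmod (X j)) {..<n} = L2_set (\<lambda>j. cmod (x n j)) {..<n}"
      by (rule L2_set_cong) (auto simp: x_def)
    also have "\<dots> \<le> l2norm (x n)" by (rule L2_set_le_l2norm[OF x2])
    also have "\<dots> = l2norm (S (y n))" using S[OF x2[of n]] unfolding y_def[abs_def] by simp
    also have "\<dots> \<le> C * l2norm (y n)" by (rule C[OF ynorm(1)])
    also have "\<dots> \<le> \<bar>C\<bar> * l2norm (y n)" by (intro mult_right_mono l2norm_nonneg ynorm(1)) auto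
    also have "\<dots> \<le> \<bar>C\<bar> * (real (J + 2) * K)" by (intro mult_left_mono ynorm(2)) auto
    finally show ?thesis .
  qed
  then have "X \<in> l2" by (rule l2_boundedI)
  with X show False by simp
qed

lemma sigma_det_subset_spectrum:
  assumes k: "k \<ge> 1"
  shows "sigma_det k a b c \<subseteq> op_spectrum (ktoep k a b c)"
proof
  fix mu assume "mu \<in> sigma_det k a b c"
  then obtain z where z: "cmod z = 1" and "det (symb k a b c z - mu \<cdot>\<^sub>m 1\<^sub>m k) = 0"
    by (auto simp: sigma_det_def)
  moreover have Mc: "symb k a b c z - mu \<cdot>\<^sub>m 1\<^sub>m k \<in> carrier_mat k k" by (simp add: minus_carrier_mat)
  ultimately obtain v where v: "v \<in> carrier_vec k" "v \<noteq> 0\<^sub>v k"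
    and Mv: "(symb k a b c z - mu \<cdot>\<^sub>m 1\<^sub>m k) *\<^sub>v v = 0\<^sub>v k"
    using det_0_iff_vec_prod_zero by blast
  have z0: "z \<noteq> 0" using z by auto
  define X where "X j = inverse z ^ (j div k) * v $ (j mod k)" for j
  have Xb: "X (m * k + i) = inverse z ^ m * v $ i" if "i < k" for m i using that by (simp add: X_def)
  have cX: "cmod (X j) = cmod (v $ (j mod k))" for j by (simp add: X_def norm_mult norm_power norm_inverse z)
  show "mu \<in> op_spectrum (ktoep k a b c)"
  proof (rule weyl_criterion[OF k, of X _ k])
    show "cmod (X j) \<le> (\<Sum>i<k. cmod (v $ i))" for j
      unfolding cX using k by (intro member_le_sum) auto
    show "X \<notin> l2"
    proof
      assume X2: "X \<in> l2"
      obtain i where i: "i < k" "v $ i \<noteq> 0" using v by (metis carrier_vecD eq_vecI index_zero_vec)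
      have "(\<lambda>m. X (m * k + i)) \<in> l2" by (rule bounded_op_l2[OF bounded_op_decimate[OF k] X2])
      then have "summable (\<lambda>m::nat. (cmod (v $ i))\<^sup>2)" using i by (simp add: l2_def cX)
      then show False using i by (simp add: summable_const_iff)
    qed
    fix j assume "k \<le> j"
    define m i where "m = j div k" and "i = j mod k"
    have j: "j = m * k + i" and i: "i < k" using k by (auto simp: m_def i_def)
    obtain m' where m': "m = Suc m'" using \<open>k \<le> j\<close> k by (cases m) (auto simp: m_def div_eq_0_iff)
    have "ktoep k a b c X j - mu * X j = (\<Sum>l<k. A0 k a b c $$ (i, l) * X (m * k + l)
      + Am1 k b $$ (i, l) * lshift (\<lambda>m. X (m * k + l)) m + Ap1 k c $$ (i, l) * rshift (\<lambda>m. X (m * k + l)) m)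
      - (\<Sum>l<k. if l = i then mu * X (m * k + l) else 0)"
      unfolding j ktoep_block[OF i] using i by simp
    also have "\<dots> = (\<Sum>l<k. inverse z ^ m * ((symb k a b c z - mu \<cdot>\<^sub>m 1\<^sub>m k) $$ (i, l) * v $ l))"
      unfolding sum_subtractf[symmetric]
    proof (intro sum.cong refl)
      fix l assume "l \<in> {..<k}"
      then have l: "l < k" by simp
      show "A0 k a b c $$ (i, l) * X (m * k + l)
        + Am1 k b $$ (i, l) * lshift (\<lambda>m. X (m * k + l)) m + Ap1 k c $$ (i, l) * rshift (\<lambda>m. X (m * k + l)) m
        - (if l = i then mu * X (m * k + l) else 0)
        = inverse z ^ m * ((symb k a b c z - mu \<cdot>\<^sub>m 1\<^sub>m k) $$ (i, l) * v $ l)"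
        unfolding symb_minus_index[OF i l] lshift_def rshift_def Xb[OF l]
        using z0 by (simp add: m' field_simps)
    qed
    also have "\<dots> = inverse z ^ m * ((symb k a b c z - mu \<cdot>\<^sub>m 1\<^sub>m k) *\<^sub>v v) $ i"
      using v(1) Mc i unfolding sum_distrib_left[symmetric]
      by (simp add: scalar_prod_def lessThan_atLeast0)
    also have "\<dots> = 0" using Mv i by simp
    finally show "ktoep k a b c X j = mu * X j" by simp
  qed
qed

lemma kernel_imp_op_spectrum:
  assumes "x \<in> l2" "x n \<noteq> 0" "\<And>j. ktoep k a b c x j = mu * x j"
  shows "mu \<in> op_spectrum (ktoep k a b c)"
proof (rule ccontr)
  assume "mu \<notin> op_spectrum (ktoep k a b c)"
  from not_in_op_spectrumD[OF this]
  obtain S where S: "\<And>x. x \<in> l2 \<Longrightarrow> S (\<lambda>j. ktoep k a b c x j - mu * x j) = x"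
    by auto
  have "x = S (\<lambda>j. 0)" using S[OF assms(1)] assms(3) by simp
  also have "\<dots> = (\<lambda>j. 0)" using S[OF zero_l2] by (simp add: ktoep_def cong: if_cong)
  finally show False using assms(2) by simp
qed

lemma l2_tendsto_0:
  assumes "x \<in> l2"
  shows "x \<longlonglongrightarrow> 0"
proof -
  have "(\<lambda>n. (cmod (x n))\<^sup>2) \<longlonglongrightarrow> 0"
    using assms unfolding l2_def by (auto dest: summable_LIMSEQ_zero)
  then have "(\<lambda>n. sqrt ((cmod (x n))\<^sup>2)) \<longlonglongrightarrow> sqrt 0" by (rule tendsto_real_sqrt)
  then show ?thesis by (simp add: tendsto_norm_zero_iff)
qed

lemma ktoep_green_identity:
  "(\<Sum>j<Suc n. ktoep k a b c x j * y j - x j * ktoep k a c b y j)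
     = b (pidx k n) * x (Suc n) * y n - c (pidx k n) * x n * y (Suc n)"
  by (induction n) (auto simp: ktoep_def algebra_simps)

lemma cokernel_imp_op_spectrum:
  assumes k: "k \<ge> 1" and y: "y \<in> l2" "y n \<noteq> 0" "\<And>j. ktoep k a c b y j = mu * y j"
  shows "mu \<in> op_spectrum (ktoep k a b c)"
proof (rule ccontr)
  assume "mu \<notin> op_spectrum (ktoep k a b c)"
  from not_in_op_spectrumD[OF this]
  obtain S where S2: "\<And>x. x \<in> l2 \<Longrightarrow> S x \<in> l2"
    and S: "\<And>x. x \<in> l2 \<Longrightarrow> (\<lambda>j. ktoep k a b c (S x) j - mu * S x j) = x"
    by auto
  have cy: "(\<lambda>j. cnj (y j)) \<in> l2" using y(1) by (simp add: l2_def)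
  define x where "x = S (\<lambda>j. cnj (y j))"
  have x2: "x \<in> l2" unfolding x_def by (rule S2[OF cy])
  have x: "ktoep k a b c x j = mu * x j + cnj (y j)" for j
    using fun_cong[OF S[OF cy], of j] by (simp add: x_def algebra_simps)
  have eq: "complex_of_real (\<Sum>j<Suc N. (cmod (y j))\<^sup>2)
      = b (pidx k N) * x (Suc N) * y N - c (pidx k N) * x N * y (Suc N)" for N
    unfolding ktoep_green_identity[symmetric, where a = a] of_real_sum
    by (intro sum.cong refl) (simp add: x y(3) complex_norm_square algebra_simps del: of_real_power)
  have B: "norm (f (pidx k N)) \<le> (\<Sum>i\<in>{1..k}. cmod (f i))" for f N
    using k by (intro member_le_sum) (auto simp: pidx_def Suc_le_eq)
  have lim: "(\<lambda>N. f (pidx k N) * (u N * w N)) \<longlonglongrightarrow> 0" if "u \<longlonglongrightarrow> 0" "w \<longlonglongrightarrow> 0" for f u w :: "nat \<Rightarrow> complex"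
    by (rule lim_null_mult_left_bounded[OF always_eventually, OF allI, OF B])
       (use tendsto_mult[OF that] in simp)
  have "(\<lambda>N. b (pidx k N) * (x (Suc N) * y N) - c (pidx k N) * (x N * y (Suc N))) \<longlonglongrightarrow> 0 - 0"
    by (intro tendsto_diff lim LIMSEQ_Suc l2_tendsto_0 x2 y(1))
  then have "(\<lambda>N. complex_of_real (\<Sum>j<Suc N. (cmod (y j))\<^sup>2)) \<longlonglongrightarrow> complex_of_real 0"
    unfolding eq by (simp add: mult.assoc)
  then have L: "(\<lambda>N. \<Sum>j<Suc N. (cmod (y j))\<^sup>2) \<longlonglongrightarrow> 0" by (rule tendsto_of_real_iff[THEN iffD1])
  have "(cmod (y n))\<^sup>2 \<le> (\<Sum>j<Suc N. (cmod (y j))\<^sup>2)" if "N \<ge> n" for N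
    using that by (intro member_le_sum) auto
  then have "(cmod (y n))\<^sup>2 \<le> 0" using LIMSEQ_le_const[OF L] by blast
  then show False using y(2) by simp
qed

section \<open>Eigenvectors from the adjugate of the symbol\<close>

text \<open>The matrix \<open>f(z) - \<mu>\<close> with its last row, the only one containing \<open>z\<inverse>\<close>, multiplied by \<open>z\<close>.\<close>

definition symb_poly :: "nat \<Rightarrow> (nat \<Rightarrow> complex) \<Rightarrow> (nat \<Rightarrow> complex) \<Rightarrow> (nat \<Rightarrow> complex) \<Rightarrow> complex \<Rightarrow> complex poly mat" where
  "symb_poly k a b c mu = mat k k (\<lambda>(i, j). (if i = k - 1 then [:0, 1:] else 1)
      * [:A0 k a b c $$ (i, j) - (if i = j then mu else 0), Ap1 k c $$ (i, j):] + [:Am1 k b $$ (i, j):])"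

lemma symb_poly_carrier [simp]: "symb_poly k a b c mu \<in> carrier_mat k k"
  by (simp add: symb_poly_def)

lemma Am1_index_eq_0: "i < k \<Longrightarrow> j < k \<Longrightarrow> i \<noteq> k - 1 \<Longrightarrow> Am1 k b $$ (i, j) = 0"
  by (simp add: Am1_def)

lemma poly_det_symb_poly:
  assumes k: "k \<ge> 1" and z: "z \<noteq> 0"
  shows "poly (det (symb_poly k a b c mu)) z = z * det (symb k a b c z - mu \<cdot>\<^sub>m 1\<^sub>m k)"
proof -
  have Mc: "symb k a b c z - mu \<cdot>\<^sub>m 1\<^sub>m k \<in> carrier_mat k k" by (simp add: minus_carrier_mat)
  have "poly (det (symb_poly k a b c mu)) z = det (multrow (k - 1) z (symb k a b c z - mu \<cdot>\<^sub>m 1\<^sub>m k))"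
  proof (rule poly_det_cong[of _ k])
    fix i j assume ij: "i < k" "j < k"
    show "poly (symb_poly k a b c mu $$ (i, j)) z
        = multrow (k - 1) z (symb k a b c z - mu \<cdot>\<^sub>m 1\<^sub>m k) $$ (i, j)"
    proof (cases "i = k - 1")
      case True
      have "multrow (k - 1) z (symb k a b c z - mu \<cdot>\<^sub>m 1\<^sub>m k) $$ (i, j)
          = z * (symb k a b c z - mu \<cdot>\<^sub>m 1\<^sub>m k) $$ (i, j)"
        using ij Mc True by (subst index_mat_multrow) auto
      then show ?thesis unfolding symb_minus_index[OF ij]
        using ij True z by (simp add: symb_poly_def algebra_simps)
    next
      case False
      have "multrow (k - 1) z (symb k a b c z - mu \<cdot>\<^sub>m 1\<^sub>m k) $$ (i, j)
          = (symb k a b c z - mu \<cdot>\<^sub>m 1\<^sub>m k) $$ (i, j)"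
        using ij Mc False by (subst index_mat_multrow) auto
      then show ?thesis unfolding symb_minus_index[OF ij]
        using ij False Am1_index_eq_0[OF ij False] by (simp add: symb_poly_def)
    qed
  qed (use Mc in auto)
  also have "\<dots> = z * det (symb k a b c z - mu \<cdot>\<^sub>m 1\<^sub>m k)"
    by (rule det_multrow[OF _ Mc]) (use k in simp)
  finally show ?thesis .
qed

lemma degree_det_symb_poly:
  assumes k: "k \<ge> 1"
  shows "degree (det (symb_poly k a b c mu)) \<le> 2"
proof -
  define r where "r i = (if i = k - 1 then 1 else 0) + (if i = 0 then 1 else 0 :: nat)" for i
  have entry: "degree (symb_poly k a b c mu $$ (i, j)) \<le> r i" if ij: "i < k" "j < k" for i j
  proof -
    let ?p = "[:A0 k a b c $$ (i, j) - (if i = j then mu else 0), Ap1 k c $$ (i, j):]"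
    have "degree ?p \<le> (if i = 0 then 1 else 0)" using ij by (auto simp: Ap1_def)
    then have "degree ((if i = k - 1 then [:0, 1:] else 1) * ?p) \<le> r i"
      unfolding r_def by (intro order.trans[OF degree_mult_le] add_mono) auto
    then show ?thesis using ij by (auto simp: symb_poly_def intro: degree_add_le)
  qed
  have rs: "(\<Sum>i = 0..<k. r i) = 2" using k by (simp add: r_def sum.distrib)
  have "degree (signof p * (\<Prod>i = 0..<k. symb_poly k a b c mu $$ (i, p i))) \<le> 2" if p: "p permutes {0..<k}" for p
  proof -
    have "degree (\<Prod>i = 0..<k. symb_poly k a b c mu $$ (i, p i))
        \<le> (\<Sum>i = 0..<k. degree (symb_poly k a b c mu $$ (i, p i)))"
      using degree_prod_sum_le[of "{0..<k}" "\<lambda>i. symb_poly k a b c mu $$ (i, p i)"] by (simp add: o_def)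
    also have "\<dots> \<le> (\<Sum>i = 0..<k. r i)"
      using permutes_in_image[OF p] by (intro sum_mono entry) auto
    finally show ?thesis unfolding rs by (auto simp: sign_def)
  qed
  then show ?thesis unfolding det_def'[OF symb_poly_carrier]
    by (intro degree_sum_le) (auto intro: finite_permutations)
qed

lemma det_symb_quadratic:
  assumes k: "k \<ge> 1"
  obtains \<alpha> \<beta> \<gamma> where "\<And>z. z \<noteq> 0 \<Longrightarrow> z * det (symb k a b c z - mu \<cdot>\<^sub>m 1\<^sub>m k) = \<beta> + \<alpha> * z + \<gamma> * z\<^sup>2"
proof -
  let ?q = "det (symb_poly k a b c mu)"
  have "z * det (symb k a b c z - mu \<cdot>\<^sub>m 1\<^sub>m k) = coeff ?q 0 + coeff ?q 1 * z + coeff ?q 2 * z\<^sup>2"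
    if "z \<noteq> 0" for z
  proof -
    have "poly (\<Sum>i\<le>2. monom (coeff ?q i) i) z = poly ?q z"
      by (simp only: poly_as_sum_of_monoms'[OF degree_det_symb_poly[OF k]])
    then show ?thesis unfolding poly_det_symb_poly[OF k that]
      by (simp add: numeral_2_eq_2 poly_sum poly_monom)
  qed
  then show ?thesis by (rule that)
qed

lemma poly_eqI_nonzero:
  fixes p q :: "complex poly"
  assumes "\<And>z. z \<noteq> 0 \<Longrightarrow> poly p z = poly q z"
  shows "p = q"
proof (rule ccontr)
  assume "p \<noteq> q"
  then have "finite {z. poly (p - q) z = 0}" by (intro poly_roots_finite) simp
  moreover have "- {0} \<subseteq> {z. poly (p - q) z = 0}" using assms by auto
  ultimately have "finite (- {0 :: complex})" using finite_subset by blast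
  then show False by (simp add: finite_compl infinite_UNIV_char_0)
qed

lemma fps_nth_linear_mult:
  "fps_nth (fps_of_poly [:u, v:] * F) n = u * fps_nth F n + v * rshift (fps_nth F) n"
  by (cases n) (simp_all add: fps_of_poly_pCons rshift_def distrib_right mult.assoc)

lemma l2_fps_divide_linear:
  assumes s: "cmod s < 1" and F: "fps_nth (fps_of_poly [:1, -s:] * F) \<in> l2"
  shows "fps_nth F \<in> l2"
  by (rule rshift_resolvent_estimate(1)[OF s F]) (simp add: fps_nth_linear_mult)

text \<open>If \<open>z det (f(z) - \<mu>)\<close> has no zeros in the closed disk, then the last column of \<open>(f(z) - \<mu>)\<inverse>\<close>,
  divided by \<open>z\<close>, is analytic there, and its Taylor coefficients are an eigenvector.\<close>

lemma kernel_exists: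
  assumes k: "k \<ge> 1" and C: "C \<noteq> 0" and s: "cmod s1 < 1" "cmod s2 < 1"
    and det: "\<And>z. z \<noteq> 0 \<Longrightarrow> z * det (symb k a b c z - mu \<cdot>\<^sub>m 1\<^sub>m k) = C * (1 - s1 * z) * (1 - s2 * z)"
  shows "\<exists>x\<in>l2. (\<exists>n. x n \<noteq> 0) \<and> (\<forall>j. ktoep k a b c x j = mu * x j)"
proof -
  define G where "G = symb_poly k a b c mu"
  have Gc: "G \<in> carrier_mat k k" by (simp add: G_def)
  define q where "q = [:1, -s1:] * ([:1, -s2:] * [:C:])"
  have detG: "det G = q"
    by (rule poly_eqI_nonzero)
       (simp add: G_def poly_det_symb_poly[OF k] det q_def algebra_simps)
  define p where "p j = adj_mat G $$ (j, k - 1)" for j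
  have Gp: "(\<Sum>j<k. G $$ (i, j) * p j) = (if i = k - 1 then q else 0)" if i: "i < k" for i
  proof -
    have "(\<Sum>j<k. G $$ (i, j) * p j) = (G * adj_mat G) $$ (i, k - 1)"
      using i k Gc adj_mat(1)[OF Gc] by (simp add: p_def scalar_prod_def lessThan_atLeast0)
    also have "\<dots> = (if i = k - 1 then q else 0)"
      unfolding adj_mat(2)[OF Gc] detG using i k by simp
    finally show ?thesis .
  qed
  have q0: "fps_nth (fps_of_poly q) 0 \<noteq> 0" using C by (simp add: q_def)
  define X where "X j = fps_of_poly (p j) * inverse (fps_of_poly q)" for j
  have GX: "(\<Sum>j<k. fps_of_poly (G $$ (i, j)) * X j) = (if i = k - 1 then 1 else 0)" if i: "i < k" for i
  proof -
    have "(\<Sum>j<k. fps_of_poly (G $$ (i, j)) * X j) = fps_of_poly (\<Sum>j<k. G $$ (i, j) * p j) * inverse (fps_of_poly q)"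
      by (simp add: X_def fps_of_poly_sum fps_of_poly_mult sum_distrib_right mult.assoc)
    then show ?thesis unfolding Gp[OF i] using q0 by (simp add: inverse_mult_eq_1')
  qed
  have X2: "fps_nth (X j) \<in> l2" for j
  proof -
    have "fps_of_poly q * X j = fps_of_poly (p j)"
      unfolding X_def using q0 by (simp add: inverse_mult_eq_1' mult.left_commute)
    moreover have "fps_nth (fps_of_poly (p j)) \<in> l2"
    proof (rule finite_support_l2(1)[of "{..degree (p j)}"])
      show "cmod (fps_nth (fps_of_poly (p j)) n) \<le> (\<Sum>i\<le>degree (p j). cmod (coeff (p j) i))" for n
        by (cases "n \<le> degree (p j)") (auto intro: member_le_sum sum_nonneg simp: coeff_eq_0)
    qed (auto simp: coeff_eq_0)
    ultimately have "fps_nth (fps_of_poly [:1, -s1:] * (fps_of_poly [:1, -s2:] * (fps_of_poly [:C:] * X j))) \<in> l2"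
      by (simp only: q_def fps_of_poly_mult mult.assoc fps_of_poly_nth)
    from l2_fps_divide_linear[OF s(2) l2_fps_divide_linear[OF s(1) this]]
    have "fps_nth (fps_of_poly [:C:] * X j) \<in> l2" .
    from l2_scale(1)[OF this, of "inverse C"] show ?thesis
      using C by (simp add: fps_of_poly_const mult.assoc[symmetric])
  qed
  define x where "x j = fps_nth (X (j mod k)) (j div k)" for j
  have xb: "(\<lambda>m. x (m * k + j)) = fps_nth (X j)" if "j < k" for j using that by (auto simp: x_def)
  have x2: "x \<in> l2" unfolding x_def[abs_def] by (rule interleave_l2[OF k X2])
  have eq: "ktoep k a b c x j = mu * x j" for j
  proof -
    define m i where "m = j div k" and "i = j mod k"
    have j: "j = m * k + i" and i: "i < k" using k by (auto simp: m_def i_def)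
    define U where "U l = fps_of_poly [:A0 k a b c $$ (i, l) - (if i = l then mu else 0), Ap1 k c $$ (i, l):] * X l" for l
    have xm: "x (m * k + l) = fps_nth (X l) m" if "l < k" for l using fun_cong[OF xb[OF that], of m] .
    have "ktoep k a b c x j - mu * x j = (\<Sum>l<k. A0 k a b c $$ (i, l) * x (m * k + l)
        + Am1 k b $$ (i, l) * lshift (\<lambda>m. x (m * k + l)) m + Ap1 k c $$ (i, l) * rshift (\<lambda>m. x (m * k + l)) m)
        - (\<Sum>l<k. if i = l then mu * x (m * k + l) else 0)"
      unfolding j ktoep_block[OF i] using i by simp
    also have "\<dots> = (\<Sum>l<k. fps_nth (U l) m + Am1 k b $$ (i, l) * fps_nth (X l) (Suc m))"
      unfolding sum_subtractf[symmetric]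
    proof (intro sum.cong refl)
      fix l assume "l \<in> {..<k}"
      then have l: "l < k" by simp
      show "A0 k a b c $$ (i, l) * x (m * k + l)
        + Am1 k b $$ (i, l) * lshift (\<lambda>m. x (m * k + l)) m + Ap1 k c $$ (i, l) * rshift (\<lambda>m. x (m * k + l)) m
        - (if i = l then mu * x (m * k + l) else 0)
        = fps_nth (U l) m + Am1 k b $$ (i, l) * fps_nth (X l) (Suc m)"
        unfolding U_def fps_nth_linear_mult xb[OF l] xm[OF l] by (simp add: lshift_def algebra_simps)
    qed
    also have "\<dots> = 0"
    proof (cases "i = k - 1")
      case True
      have "fps_of_poly (G $$ (i, l)) * X l = fps_X * U l + fps_const (Am1 k b $$ (i, l)) * X l" if "l < k" for l
        using that i True
        by (simp add: G_def symb_poly_def U_def fps_of_poly_add fps_of_poly_mult fps_of_poly_const distrib_right mult.assoc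
            fps_of_poly_fps_X del: mult_pCons_left mult_pCons_right)
      then have "(\<Sum>l<k. fps_X * U l + fps_const (Am1 k b $$ (i, l)) * X l) = 1"
        using GX[OF i] True by simp
      from arg_cong[OF this, of "\<lambda>F. fps_nth F (Suc m)"] show ?thesis by (simp add: fps_sum_nth)
    next
      case False
      have "fps_of_poly (G $$ (i, l)) * X l = U l" if "l < k" for l
        using that i False Am1_index_eq_0[OF i that False] by (simp add: G_def symb_poly_def U_def)
      then have "(\<Sum>l<k. U l) = 0" using GX[OF i] False by simp
      from arg_cong[OF this, of "\<lambda>F. fps_nth F m"] show ?thesis
        using Am1_index_eq_0[OF i _ False] by (simp add: fps_sum_nth)
    qed
    finally show ?thesis by simp
  qed
  have "\<exists>n. x n \<noteq> 0"
  proof (rule ccontr)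
    assume "\<not> (\<exists>n. x n \<noteq> 0)"
    then have "X j = 0" if "j < k" for j
      using xb[OF that] by (intro fps_ext) (metis fps_zero_nth)
    then have "(\<Sum>j<k. fps_of_poly (G $$ (k - 1, j)) * X j) = 0" by simp
    then show False using GX[of "k - 1"] k by simp
  qed
  with x2 eq show ?thesis by blast
qed

lemma det_symb_swap:
  assumes k: "k \<ge> 1"
  shows "det (symb k a c b z - mu \<cdot>\<^sub>m 1\<^sub>m k) = det (symb k a b c (inverse z) - mu \<cdot>\<^sub>m 1\<^sub>m k)"
proof -
  have Mc: "symb k a b c (inverse z) - mu \<cdot>\<^sub>m 1\<^sub>m k \<in> carrier_mat k k" by (simp add: minus_carrier_mat)
  have Mc': "symb k a c b z - mu \<cdot>\<^sub>m 1\<^sub>m k \<in> carrier_mat k k" by (simp add: minus_carrier_mat)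
  have "symb k a c b z - mu \<cdot>\<^sub>m 1\<^sub>m k = transpose_mat (symb k a b c (inverse z) - mu \<cdot>\<^sub>m 1\<^sub>m k)"
  proof (rule eq_matI)
    fix i j assume "i < dim_row (transpose_mat (symb k a b c (inverse z) - mu \<cdot>\<^sub>m 1\<^sub>m k))"
      "j < dim_col (transpose_mat (symb k a b c (inverse z) - mu \<cdot>\<^sub>m 1\<^sub>m k))"
    then have ij: "i < k" "j < k" using Mc by auto
    have "transpose_mat (symb k a b c (inverse z) - mu \<cdot>\<^sub>m 1\<^sub>m k) $$ (i, j)
        = (symb k a b c (inverse z) - mu \<cdot>\<^sub>m 1\<^sub>m k) $$ (j, i)"
      using ij Mc by (intro index_transpose_mat) auto
    then show "(symb k a c b z - mu \<cdot>\<^sub>m 1\<^sub>m k) $$ (i, j)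
        = transpose_mat (symb k a b c (inverse z) - mu \<cdot>\<^sub>m 1\<^sub>m k) $$ (i, j)"
      unfolding symb_minus_index[OF ij] symb_minus_index[OF ij(2,1)]
      using ij by (auto simp: A0_def Am1_def Ap1_def)
  qed (use Mc Mc' in auto)
  then show ?thesis using det_transpose[OF Mc] by simp
qed

section \<open>Schur complement\<close>

lemma not_in_op_spectrumI:
  assumes k: "k \<ge> 1" and S: "bounded_op S"
    and inv: "\<And>y j. y \<in> l2 \<Longrightarrow> ktoep k a b c (S y) j - mu * S y j = y j"
    and ker: "\<And>x j. x \<in> l2 \<Longrightarrow> (\<And>j. ktoep k a b c x j - mu * x j = 0) \<Longrightarrow> x j = 0"
  shows "mu \<notin> op_spectrum (ktoep k a b c)"
proof -
  have left: "S (\<lambda>j. ktoep k a b c x j - mu * x j) = x" if x: "x \<in> l2" for x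
  proof
    fix n
    define y where "y = (\<lambda>j. ktoep k a b c x j - mu * x j)"
    have y2: "y \<in> l2"
      unfolding y_def by (intro l2_diff l2_scale(1) x bounded_op_l2[OF bounded_op_ktoep[OF k]])
    have w2: "(\<lambda>j. S y j - x j) \<in> l2" by (intro l2_diff x bounded_op_l2[OF S] y2)
    have "S y n - x n = 0"
    proof (rule ker[OF w2])
      fix j
      have "ktoep k a b c (\<lambda>j. S y j - x j) j - mu * (S y j - x j)
        = (ktoep k a b c (S y) j - mu * S y j) - (ktoep k a b c x j - mu * x j)"
        by (simp add: ktoep_def algebra_simps)
      also have "\<dots> = 0" unfolding inv[OF y2] by (simp add: y_def)
      finally show "ktoep k a b c (\<lambda>j. S y j - x j) j - mu * (S y j - x j) = 0" .
    qed
    then show "S (\<lambda>j. ktoep k a b c x j - mu * x j) n = x n" by (simp add: y_def)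
  qed
  have right: "(\<lambda>j. ktoep k a b c (S x) j - mu * S x j) = x" if "x \<in> l2" for x
    using inv[OF that] by (intro ext)
  obtain C where C: "\<forall>x\<in>l2. S x \<in> l2 \<and> l2norm (S x) \<le> C * l2norm x"
    using S unfolding bounded_op_def by blast
  have "(\<forall>x\<in>l2. S x \<in> l2) \<and> (\<exists>C. \<forall>x\<in>l2. l2norm (S x) \<le> C * l2norm x)
      \<and> (\<forall>x\<in>l2. S (\<lambda>j. ktoep k a b c x j - mu * x j) = x \<and> (\<lambda>j. ktoep k a b c (S x) j - mu * S x j) = x)"
    using C left right by auto
  then show ?thesis unfolding op_spectrum_def by (simp only: mem_Collect_eq not_not) (rule exI)
qed

text \<open>Schur complement with respect to the first \<open>k - 1\<close> components of each block: \<open>E\<close> is the inverse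
  of \<open>B\<^sub>0 - \<mu>\<close>, and \<open>\<delta>\<close>, \<open>\<tau>\<close>, \<open>\<rho>\<close> are the coefficients of \<open>1\<close>, \<open>z\<inverse>\<close>, \<open>z\<close> in the
  complement, the symbol of a scalar Toeplitz operator acting on the last components.\<close>

locale schur_reduction =
  fixes k :: nat and a b c :: "nat \<Rightarrow> complex" and mu :: complex and E :: "nat \<Rightarrow> nat \<Rightarrow> complex" and n :: nat
  assumes k: "k = Suc n"
    and DE: "\<And>i j. i < n \<Longrightarrow> j < n \<Longrightarrow>
      (\<Sum>l<n. (A0 k a b c $$ (i, l) - (if i = l then mu else 0)) * E l j) = (if i = j then 1 else 0)"
    and ED: "\<And>i j. i < n \<Longrightarrow> j < n \<Longrightarrow>
      (\<Sum>l<n. E i l * (A0 k a b c $$ (l, j) - (if l = j then mu else 0))) = (if i = j then 1 else 0)"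
begin

definition D :: "nat \<Rightarrow> nat \<Rightarrow> complex" where
  "D i j = A0 k a b c $$ (i, j) - (if i = j then mu else 0)"

definition E_sup :: "nat \<Rightarrow> complex" where "E_sup j = (\<Sum>l<n. E j l * A0 k a b c $$ (l, n))"

definition E_wrap :: "nat \<Rightarrow> complex" where "E_wrap j = (\<Sum>l<n. E j l * Ap1 k c $$ (l, n))"

definition \<delta> :: complex where
  "\<delta> = D n n - (\<Sum>j<n. A0 k a b c $$ (n, j) * E_sup j) - (\<Sum>j<n. Am1 k b $$ (n, j) * E_wrap j)"

definition \<tau> :: complex where
  "\<tau> = Am1 k b $$ (n, n) - (\<Sum>j<n. Am1 k b $$ (n, j) * E_sup j)"

definition \<rho> :: complex where
  "\<rho> = Ap1 k c $$ (n, n) - (\<Sum>j<n. A0 k a b c $$ (n, j) * E_wrap j)"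

lemma less_k: "n < k" "l < n \<Longrightarrow> l < k"
  using k by auto

lemma Am1_upper: "i < n \<Longrightarrow> j < k \<Longrightarrow> Am1 k b $$ (i, j) = 0"
  by (simp add: k Am1_def)

lemma Ap1_left: "i < k \<Longrightarrow> j < n \<Longrightarrow> Ap1 k c $$ (i, j) = 0"
  by (simp add: k Ap1_def)

lemma D_E: "i < n \<Longrightarrow> (\<Sum>j<n. D i j * (\<Sum>l<n. E j l * v l)) = v i"
proof -
  assume i: "i < n"
  have "(\<Sum>j<n. D i j * (\<Sum>l<n. E j l * v l)) = (\<Sum>l<n. (\<Sum>j<n. D i j * E j l) * v l)"
    unfolding sum_distrib_left sum_distrib_right by (subst sum.swap) (simp add: mult.assoc)
  also have "\<dots> = (\<Sum>l<n. if i = l then v l else 0)"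
    using DE[OF i] by (intro sum.cong) (auto simp: D_def)
  finally show ?thesis using i by simp
qed

lemma E_D: "i < n \<Longrightarrow> (\<Sum>j<n. E i j * (\<Sum>l<n. D j l * v l)) = v i"
proof -
  assume i: "i < n"
  have "(\<Sum>j<n. E i j * (\<Sum>l<n. D j l * v l)) = (\<Sum>l<n. (\<Sum>j<n. E i j * D j l) * v l)"
    unfolding sum_distrib_left sum_distrib_right by (subst sum.swap) (simp add: mult.assoc)
  also have "\<dots> = (\<Sum>l<n. if i = l then v l else 0)"
    using ED[OF i] by (intro sum.cong) (auto simp: D_def)
  finally show ?thesis using i by simp
qed

lemma ktoep_minus_upper:
  assumes i: "i < n"
  shows "ktoep k a b c x (m * k + i) - mu * x (m * k + i)
    = (\<Sum>j<n. D i j * x (m * k + j)) + A0 k a b c $$ (i, n) * x (m * k + n)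
      + Ap1 k c $$ (i, n) * rshift (\<lambda>m. x (m * k + n)) m"
proof -
  have ik: "i < k" using i k by simp
  have "ktoep k a b c x (m * k + i) = (\<Sum>j<Suc n. A0 k a b c $$ (i, j) * x (m * k + j)
      + Ap1 k c $$ (i, j) * rshift (\<lambda>m. x (m * k + j)) m)"
    unfolding ktoep_block[OF ik] k[symmetric]
    by (intro sum.cong refl) (use i in \<open>simp add: Am1_upper\<close>)
  also have "\<dots> = (\<Sum>j<n. A0 k a b c $$ (i, j) * x (m * k + j)) + A0 k a b c $$ (i, n) * x (m * k + n)
      + Ap1 k c $$ (i, n) * rshift (\<lambda>m. x (m * k + n)) m"
    using ik by (simp add: Ap1_left)
  also have "(\<Sum>j<n. A0 k a b c $$ (i, j) * x (m * k + j)) = (\<Sum>j<n. D i j * x (m * k + j) + (if i = j then mu * x (m * k + j) else 0))"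
    by (intro sum.cong) (auto simp: D_def algebra_simps)
  also have "\<dots> = (\<Sum>j<n. D i j * x (m * k + j)) + mu * x (m * k + i)"
    using i by (simp add: sum.distrib)
  finally show ?thesis by simp
qed

lemma ktoep_minus_last:
  "ktoep k a b c x (m * k + n) - mu * x (m * k + n)
    = (\<Sum>j<n. A0 k a b c $$ (n, j) * x (m * k + j) + Am1 k b $$ (n, j) * x (Suc m * k + j))
      + D n n * x (m * k + n) + Am1 k b $$ (n, n) * x (Suc m * k + n)
      + Ap1 k c $$ (n, n) * rshift (\<lambda>m. x (m * k + n)) m"
proof -
  have nk: "n < k" using k by simp
  have "ktoep k a b c x (m * k + n) = (\<Sum>j<Suc n. A0 k a b c $$ (n, j) * x (m * k + j)
      + Am1 k b $$ (n, j) * x (Suc m * k + j) + Ap1 k c $$ (n, j) * rshift (\<lambda>m. x (m * k + j)) m)"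
    unfolding ktoep_block[OF nk] k[symmetric] by (simp only: lshift_def)
  also have "\<dots> = (\<Sum>j<n. A0 k a b c $$ (n, j) * x (m * k + j) + Am1 k b $$ (n, j) * x (Suc m * k + j))
      + (A0 k a b c $$ (n, n) * x (m * k + n) + Am1 k b $$ (n, n) * x (Suc m * k + n)
         + Ap1 k c $$ (n, n) * rshift (\<lambda>m. x (m * k + n)) m)"
    unfolding sum.lessThan_Suc using nk by (simp add: Ap1_left)
  finally show ?thesis by (simp add: D_def algebra_simps)
qed

lemma last_row_eliminated:
  assumes U: "\<And>j m. j < n \<Longrightarrow> U j m = V j m - E_sup j * s m - E_wrap j * rshift s m"
  shows "(\<Sum>j<n. A0 k a b c $$ (n, j) * U j m + Am1 k b $$ (n, j) * U j (Suc m))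
      + D n n * s m + Am1 k b $$ (n, n) * s (Suc m) + Ap1 k c $$ (n, n) * rshift s m
    = (\<Sum>j<n. A0 k a b c $$ (n, j) * V j m + Am1 k b $$ (n, j) * V j (Suc m))
      + (\<delta> * s m + \<tau> * lshift s m + \<rho> * rshift s m)"
proof -
  have r: "rshift s (Suc m) = s m" by (simp add: rshift_def)
  have "(\<Sum>j<n. A0 k a b c $$ (n, j) * U j m + Am1 k b $$ (n, j) * U j (Suc m))
    = (\<Sum>j<n. (A0 k a b c $$ (n, j) * V j m + Am1 k b $$ (n, j) * V j (Suc m))
        - A0 k a b c $$ (n, j) * E_sup j * s m - Am1 k b $$ (n, j) * E_wrap j * s m
        - Am1 k b $$ (n, j) * E_sup j * s (Suc m) - A0 k a b c $$ (n, j) * E_wrap j * rshift s m)"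
    by (intro sum.cong refl) (simp add: U r algebra_simps)
  also have "\<dots> = (\<Sum>j<n. A0 k a b c $$ (n, j) * V j m + Am1 k b $$ (n, j) * V j (Suc m))
        - (\<Sum>j<n. A0 k a b c $$ (n, j) * E_sup j) * s m - (\<Sum>j<n. Am1 k b $$ (n, j) * E_wrap j) * s m
        - (\<Sum>j<n. Am1 k b $$ (n, j) * E_sup j) * s (Suc m)
        - (\<Sum>j<n. A0 k a b c $$ (n, j) * E_wrap j) * rshift s m"
    by (simp only: sum_subtractf sum_distrib_right)
  finally show ?thesis
    by (simp add: \<delta>_def \<tau>_def \<rho>_def lshift_def algebra_simps)
qed

lemma resolvent_exists:
  assumes C: "C \<noteq> 0" and r: "cmod r < 1" and s: "cmod s < 1"
    and coef: "\<delta> = C * (1 + r * s)" "\<tau> = - C * r" "\<rho> = - C * s"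
  shows "mu \<notin> op_spectrum (ktoep k a b c)"
proof -
  have k1: "k \<ge> 1" using k by simp
  define V where "V j y m = (\<Sum>l<n. E j l * y (m * k + l))" for j y m
  define h where "h y m = y (m * k + n)
      - (\<Sum>j<n. A0 k a b c $$ (n, j) * V j y m + Am1 k b $$ (n, j) * lshift (V j y) m)" for y m
  define w where "w y = rshift_resolvent s (lshift_resolvent r (\<lambda>m. inverse C * h y m))" for y
  define U where "U j y m = V j y m - E_sup j * w y m - E_wrap j * rshift (w y) m" for j y m
  define A where "A j = (if j = n then w else U j)" for j
  define S where "S y j = A (j mod k) y (j div k)" for y j
  have bV: "bounded_op (V j)" for j
    unfolding V_def by (intro bounded_op_sum bounded_op_scale bounded_op_decimate k1 finite_lessThan)
  have bh: "bounded_op h"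
    unfolding h_def
    by (intro bounded_op_diff bounded_op_sum bounded_op_add bounded_op_scale bounded_op_decimate
        bounded_op_lshift bV k1 finite_lessThan)
  have bw: "bounded_op w"
    unfolding w_def
    by (intro bounded_op_comp[OF bounded_op_rshift_resolvent[OF s]]
        bounded_op_comp[OF bounded_op_lshift_resolvent[OF r]] bounded_op_scale bh)
  have bU: "bounded_op (U j)" for j
    unfolding U_def by (intro bounded_op_diff bounded_op_scale bounded_op_rshift bV bw)
  have bS: "bounded_op S"
    unfolding S_def by (intro bounded_op_interleave k1) (simp add: A_def bw bU)
  have SA: "S y (m * k + j) = A j y m" if "j < k" for y m j using that by (simp add: S_def)
  have SU: "S y (m * k + j) = U j y m" if "j < n" for y m j using that k SA[of j] by (simp add: A_def)
  have Sw: "S y (m * k + n) = w y m" for y m using k SA[of n] by (simp add: A_def)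
  have inv: "ktoep k a b c (S y) j - mu * S y j = y j" if y: "y \<in> l2" for y j
  proof -
    define m i where "m = j div k" and "i = j mod k"
    have j: "j = m * k + i" and i: "i < k" using less_k(1) by (auto simp: m_def i_def)
    show ?thesis
    proof (cases "i = n")
      case True
      have "ktoep k a b c (S y) j - mu * S y j
        = (\<Sum>j<n. A0 k a b c $$ (n, j) * U j y m + Am1 k b $$ (n, j) * U j y (Suc m))
          + D n n * w y m + Am1 k b $$ (n, n) * w y (Suc m) + Ap1 k c $$ (n, n) * rshift (w y) m"
        unfolding j True unfolding ktoep_minus_last unfolding Sw
        by (intro arg_cong2[of _ _ _ _ "(+)"] refl sum.cong) (simp_all only: SU lessThan_iff)
      also have "\<dots> = (\<Sum>j<n. A0 k a b c $$ (n, j) * V j y m + Am1 k b $$ (n, j) * V j y (Suc m))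
          + (\<delta> * w y m + \<tau> * lshift (w y) m + \<rho> * rshift (w y) m)"
        by (rule last_row_eliminated) (simp add: U_def)
      also have "\<delta> * w y m + \<tau> * lshift (w y) m + \<rho> * rshift (w y) m = h y m"
        using scalar_toeplitz_inverse[OF C r s bounded_op_l2[OF bh y], of m]
        unfolding w_def[symmetric] coef by (simp add: algebra_simps)
      finally show ?thesis unfolding j True by (simp add: h_def lshift_def)
    next
      case False
      with i k have i: "i < n" by simp
      have "ktoep k a b c (S y) j - mu * S y j
        = (\<Sum>l<n. D i l * U l y m) + A0 k a b c $$ (i, n) * w y m + Ap1 k c $$ (i, n) * rshift (w y) m"
        unfolding j unfolding ktoep_minus_upper[OF i] unfolding Sw
        by (intro arg_cong2[of _ _ _ _ "(+)"] refl sum.cong) (simp_all only: SU lessThan_iff)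
      also have "(\<Sum>l<n. D i l * U l y m) = (\<Sum>l<n. D i l * V l y m)
          - (\<Sum>l<n. D i l * E_sup l) * w y m - (\<Sum>l<n. D i l * E_wrap l) * rshift (w y) m"
        by (simp add: U_def right_diff_distrib sum_subtractf sum_distrib_right mult.assoc)
      also have "\<dots> = y (m * k + i) - A0 k a b c $$ (i, n) * w y m - Ap1 k c $$ (i, n) * rshift (w y) m"
        unfolding V_def E_sup_def E_wrap_def D_E[OF i] ..
      finally show ?thesis unfolding j by simp
    qed
  qed
  have ker: "x j = 0" if x: "x \<in> l2" and 0: "\<And>j. ktoep k a b c x j - mu * x j = 0" for x j
  proof -
    define w where "w m = x (m * k + n)" for m
    have w2: "w \<in> l2" unfolding w_def[abs_def] by (rule bounded_op_l2[OF bounded_op_decimate[OF k1] x])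
    have U: "x (m * k + i) = 0 - E_sup i * w m - E_wrap i * rshift w m" if i: "i < n" for i m
    proof -
      have solve: "u = - p - q" if "u + p + q = 0" for u p q :: complex
      proof -
        have "u = (u + p + q) - p - q" by simp
        then show ?thesis unfolding that by simp
      qed
      have "(\<Sum>l<n. D l' l * x (m * k + l)) = - (A0 k a b c $$ (l', n) * w m) - Ap1 k c $$ (l', n) * rshift w m"
        if "l' < n" for l'
        using ktoep_minus_upper[OF that, of x m, unfolded 0, symmetric] unfolding w_def[symmetric]
        by (rule solve)
      then have "(\<Sum>l'<n. E i l' * (\<Sum>l<n. D l' l * x (m * k + l)))
          = (\<Sum>l'<n. E i l' * (- (A0 k a b c $$ (l', n) * w m) - Ap1 k c $$ (l', n) * rshift w m))"
        by (intro sum.cong) auto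
      also have "\<dots> = 0 - E_sup i * w m - E_wrap i * rshift w m"
        by (simp add: E_sup_def E_wrap_def right_diff_distrib sum_subtractf sum_distrib_right sum_negf mult.assoc)
      finally show ?thesis unfolding E_D[OF i] .
    qed
    have "C * (1 + r * s) * w m - C * r * lshift w m - C * s * rshift w m = 0" for m
    proof -
      have "\<delta> * w m + \<tau> * lshift w m + \<rho> * rshift w m = 0"
        using last_row_eliminated[of "\<lambda>i m. x (m * k + i)" "\<lambda>_ _. 0" w m, OF U]
          ktoep_minus_last[of x m] 0[of "m * k + n"] unfolding w_def[symmetric] by simp
      then show ?thesis unfolding coef by simp
    qed
    from scalar_toeplitz_injective[OF C r s w2 this] have w0: "w m = 0" for m .
    have "x (j div k * k + j mod k) = 0"
    proof (cases "j mod k = n")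
      case True
      then show ?thesis using w0[of "j div k"] by (simp only: w_def)
    next
      case False
      moreover have "j mod k < k" using k by simp
      ultimately have "j mod k < n" using k by linarith
      from U[OF this, of "j div k"] show ?thesis by (simp add: rshift_def w0)
    qed
    then show "x j = 0" by simp
  qed
  show ?thesis by (rule not_in_op_spectrumI[OF k1 bS]) (fact inv, fact ker)
qed

lemma det_symb_schur:
  assumes z: "z \<noteq> 0"
  shows "det (symb k a b c z - mu \<cdot>\<^sub>m 1\<^sub>m k) = (\<delta> + \<tau> * inverse z + \<rho> * z) * det (char_matrix (B0 k a b c) mu)"
proof -
  define M where "M = symb k a b c z - mu \<cdot>\<^sub>m 1\<^sub>m k"
  have Mc: "M \<in> carrier_mat k k" by (simp add: M_def minus_carrier_mat)
  define W where "W = mat k k (\<lambda>(i, j). if i = j then 1 else if j = n then - (E_sup i + z * E_wrap i) else 0)"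
  have Wc: "W \<in> carrier_mat k k" by (simp add: W_def)
  have Mix: "M $$ (i, j) = inverse z * Am1 k b $$ (i, j) + A0 k a b c $$ (i, j) + z * Ap1 k c $$ (i, j) - (if i = j then mu else 0)"
    if "i < k" "j < k" for i j
    unfolding M_def by (rule symb_minus_index[OF that])
  have MW: "(M * W) $$ (i, j) = (\<Sum>l<n. M $$ (i, l) * W $$ (l, j)) + M $$ (i, n) * W $$ (n, j)" if "i < k" "j < k" for i j
  proof -
    have "(M * W) $$ (i, j) = (\<Sum>l<Suc n. M $$ (i, l) * W $$ (l, j))"
      using that Mc Wc unfolding k[symmetric] by (simp add: scalar_prod_def lessThan_atLeast0)
    then show ?thesis by simp
  qed
  have MW_left: "(M * W) $$ (i, j) = M $$ (i, j)" if "i < k" "j < n" for i j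
  proof -
    have "(\<Sum>l<n. M $$ (i, l) * W $$ (l, j)) = (\<Sum>l<n. if l = j then M $$ (i, l) else 0)"
      using that k by (intro sum.cong) (auto simp: W_def)
    moreover have "W $$ (n, j) = 0" using that k by (simp add: W_def)
    ultimately show ?thesis using that k MW[of i j] by simp
  qed
  have MW_last: "(M * W) $$ (i, n) = M $$ (i, n) - (\<Sum>l<n. M $$ (i, l) * (E_sup l + z * E_wrap l))" if "i < k" for i
  proof -
    have "(\<Sum>l<n. M $$ (i, l) * W $$ (l, n)) = (\<Sum>l<n. - (M $$ (i, l) * (E_sup l + z * E_wrap l)))"
      using k by (intro sum.cong) (auto simp: W_def algebra_simps)
    moreover have "W $$ (n, n) = 1" using k by (simp add: W_def)
    ultimately show ?thesis using that k MW[of i n] by (simp add: sum_negf)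
  qed
  have M_upper: "M $$ (i, l) = D i l" if "i < n" "l < n" for i l
    using that by (simp add: Mix less_k Am1_upper Ap1_left D_def)
  have M_last: "M $$ (n, l) = inverse z * Am1 k b $$ (n, l) + A0 k a b c $$ (n, l)" if "l < n" for l
    using that by (simp add: Mix less_k Ap1_left)
  have upper: "(M * W) $$ (i, n) = 0" if i: "i < n" for i
  proof -
    have "(\<Sum>l<n. M $$ (i, l) * (E_sup l + z * E_wrap l)) = (\<Sum>l<n. D i l * E_sup l) + z * (\<Sum>l<n. D i l * E_wrap l)"
      unfolding sum_distrib_left sum.distrib[symmetric]
      using i by (intro sum.cong) (auto simp: M_upper algebra_simps)
    also have "\<dots> = A0 k a b c $$ (i, n) + z * Ap1 k c $$ (i, n)"
      unfolding E_sup_def E_wrap_def D_E[OF i] ..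
    finally show ?thesis using i by (simp add: MW_last Mix less_k Am1_upper)
  qed
  have corner: "(M * W) $$ (n, n) = \<delta> + \<tau> * inverse z + \<rho> * z"
  proof -
    have "(\<Sum>l<n. M $$ (n, l) * (E_sup l + z * E_wrap l))
      = (\<Sum>l<n. A0 k a b c $$ (n, l) * E_sup l) + (\<Sum>l<n. Am1 k b $$ (n, l) * E_wrap l)
        + inverse z * (\<Sum>l<n. Am1 k b $$ (n, l) * E_sup l) + z * (\<Sum>l<n. A0 k a b c $$ (n, l) * E_wrap l)"
      unfolding sum_distrib_left sum.distrib[symmetric]
      using z by (intro sum.cong) (auto simp: M_last field_simps)
    then show ?thesis by (simp add: less_k MW_last Mix \<delta>_def \<tau>_def \<rho>_def D_def algebra_simps)
  qed
  have "det W = 1"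
  proof -
    have "upper_triangular W" using k by (auto simp: W_def upper_triangular_def)
    then have "det W = prod_list (diag_mat W)" by (rule det_upper_triangular[OF _ Wc])
    also have "diag_mat W = map (\<lambda>i. 1) [0..<k]" by (auto simp: diag_mat_def W_def)
    finally show ?thesis by (simp add: map_replicate_const)
  qed
  then have "det M = det (M * W)" using det_mult[OF Mc Wc] by simp
  also have "\<dots> = (\<Sum>i<k. (M * W) $$ (i, n) * cofactor (M * W) i n)"
    by (rule laplace_expansion_column) (use Mc Wc k in auto)
  also have "\<dots> = (M * W) $$ (n, n) * cofactor (M * W) n n"
    unfolding k sum.lessThan_Suc using upper by simp
  also have "cofactor (M * W) n n = det (mat_delete (M * W) n n)"
    unfolding cofactor_def by (simp add: mult_2[symmetric])
  also have "mat_delete (M * W) n n = char_matrix (B0 k a b c) mu"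
  proof (rule eq_matI)
    fix i j assume "i < dim_row (char_matrix (B0 k a b c) mu)" "j < dim_col (char_matrix (B0 k a b c) mu)"
    then have ij: "i < n" "j < n" using k by (auto simp: char_matrix_def B0_def)
    have "mat_delete (M * W) n n $$ (i, j) = (M * W) $$ (i, j)"
      using ij Mc Wc k by (simp add: mat_delete_def)
    also have "\<dots> = D i j" using ij by (simp add: MW_left less_k M_upper)
    also have "\<dots> = char_matrix (B0 k a b c) mu $$ (i, j)"
      unfolding D_def using ij k by (simp add: char_matrix_def B0_def)
    finally show "mat_delete (M * W) n n $$ (i, j) = char_matrix (B0 k a b c) mu $$ (i, j)" .
  qed (use Mc Wc k in \<open>auto simp: char_matrix_def B0_def\<close>)
  finally show ?thesis unfolding corner unfolding M_def .
qed

end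

lemma schur_reduction_exists:
  assumes k: "k = Suc n" and ev: "\<not> eigenvalue (B0 k a b c) mu"
  obtains E where "schur_reduction k a b c mu E n"
proof -
  define G where "G = char_matrix (B0 k a b c) mu"
  have Bc: "B0 k a b c \<in> carrier_mat n n" using k by (simp add: B0_def)
  have Gc: "G \<in> carrier_mat n n" unfolding G_def using Bc by simp
  have G: "G $$ (i, j) = A0 k a b c $$ (i, j) - (if i = j then mu else 0)" if "i < n" "j < n" for i j
    using that k by (simp add: G_def char_matrix_def B0_def)
  have d: "det G \<noteq> 0" using ev eigenvalue_det[OF Bc] unfolding G_def by blast
  define E where "E i j = adj_mat G $$ (i, j) / det G" for i j
  have "schur_reduction k a b c mu E n"
  proof (rule schur_reduction.intro[OF k])
    fix i j assume ij: "i < n" "j < n"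
    have "(\<Sum>l<n. (A0 k a b c $$ (i, l) - (if i = l then mu else 0)) * E l j) = (\<Sum>l<n. G $$ (i, l) * adj_mat G $$ (l, j)) / det G"
      unfolding sum_divide_distrib using ij by (intro sum.cong) (auto simp: G E_def)
    also have "(\<Sum>l<n. G $$ (i, l) * adj_mat G $$ (l, j)) = (G * adj_mat G) $$ (i, j)"
      using ij Gc adj_mat(1)[OF Gc] by (simp add: scalar_prod_def lessThan_atLeast0)
    finally show "(\<Sum>l<n. (A0 k a b c $$ (i, l) - (if i = l then mu else 0)) * E l j) = (if i = j then 1 else 0)"
      unfolding adj_mat(2)[OF Gc] using ij d by simp
    have "(\<Sum>l<n. E i l * (A0 k a b c $$ (l, j) - (if l = j then mu else 0))) = (\<Sum>l<n. adj_mat G $$ (i, l) * G $$ (l, j)) / det G"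
      unfolding sum_divide_distrib using ij by (intro sum.cong) (auto simp: G E_def)
    also have "(\<Sum>l<n. adj_mat G $$ (i, l) * G $$ (l, j)) = (adj_mat G * G) $$ (i, j)"
      using ij Gc adj_mat(1)[OF Gc] by (simp add: scalar_prod_def lessThan_atLeast0)
    finally show "(\<Sum>l<n. E i l * (A0 k a b c $$ (l, j) - (if l = j then mu else 0))) = (if i = j then 1 else 0)"
      unfolding adj_mat(3)[OF Gc] using ij d by simp
  qed
  then show ?thesis by (rule that)
qed

section \<open>The spectrum\<close>

lemma op_spectrum_if_outside:
  assumes k: "k \<ge> 1" and C: "C \<noteq> 0" and s: "cmod s1 < 1" "cmod s2 < 1"
    and det: "\<And>z. z \<noteq> 0 \<Longrightarrow> z * det (symb k a b c z - mu \<cdot>\<^sub>m 1\<^sub>m k) = C * (1 - s1 * z) * (1 - s2 * z)"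
  shows "mu \<in> op_spectrum (ktoep k a b c)"
proof -
  obtain x where x: "x \<in> l2" "(\<exists>n. x n \<noteq> 0) \<and> (\<forall>j. ktoep k a b c x j = mu * x j)"
    using kernel_exists[OF k C s det] by (rule bexE)
  obtain n where "x n \<noteq> 0" using x(2) by blast
  then show ?thesis by (rule kernel_imp_op_spectrum[OF x(1)]) (use x(2) in simp)
qed

lemma op_spectrum_if_inside:
  assumes k: "k \<ge> 1" and C: "C \<noteq> 0" and r: "cmod r1 < 1" "cmod r2 < 1"
    and det: "\<And>z. z \<noteq> 0 \<Longrightarrow> z * det (symb k a b c z - mu \<cdot>\<^sub>m 1\<^sub>m k) = C * (z - r1) * (z - r2)"
  shows "mu \<in> op_spectrum (ktoep k a b c)"
proof -
  have "z * det (symb k a c b z - mu \<cdot>\<^sub>m 1\<^sub>m k) = C * (1 - r1 * z) * (1 - r2 * z)" if z: "z \<noteq> 0" for z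
  proof -
    have "z * det (symb k a c b z - mu \<cdot>\<^sub>m 1\<^sub>m k)
        = z\<^sup>2 * (inverse z * det (symb k a b c (inverse z) - mu \<cdot>\<^sub>m 1\<^sub>m k))"
      unfolding det_symb_swap[OF k, where b = b and c = c and z = z] using z by (simp add: power2_eq_square)
    also have "\<dots> = z\<^sup>2 * (C * (inverse z - r1) * (inverse z - r2))"
      using det[of "inverse z"] z by simp
    also have "\<dots> = C * (1 - r1 * z) * (1 - r2 * z)"
      using z by (simp add: field_simps power2_eq_square)
    finally show ?thesis .
  qed
  from kernel_exists[OF k C r this]
  obtain y where y: "y \<in> l2" "(\<exists>n. y n \<noteq> 0) \<and> (\<forall>j. ktoep k a c b y j = mu * y j)"
    by (rule bexE)
  obtain n where "y n \<noteq> 0" using y(2) by blast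
  then show ?thesis by (rule cokernel_imp_op_spectrum[OF k y(1)]) (use y(2) in simp)
qed

lemma not_op_spectrum_if_mixed:
  assumes k: "k \<ge> 1" and C: "C \<noteq> 0" and r: "cmod r < 1" and s: "cmod s < 1"
    and det: "\<And>z. z \<noteq> 0 \<Longrightarrow> z * det (symb k a b c z - mu \<cdot>\<^sub>m 1\<^sub>m k) = C * (z - r) * (1 - s * z)"
    and ev: "\<not> eigenvalue (B0 k a b c) mu"
  shows "mu \<notin> op_spectrum (ktoep k a b c)"
proof -
  obtain n where n: "k = Suc n" using k by (cases k) auto
  obtain E where "schur_reduction k a b c mu E n" using schur_reduction_exists[OF n ev] .
  then interpret schur_reduction k a b c mu E n .
  define d where "d = det (char_matrix (B0 k a b c) mu)"
  have Bc: "B0 k a b c \<in> carrier_mat n n" using n by (simp add: B0_def)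
  have d: "d \<noteq> 0" using ev eigenvalue_det[OF Bc] unfolding d_def by blast
  have eq: "\<tau> + \<delta> * z + \<rho> * z\<^sup>2 = C / d * ((z - r) * (1 - s * z))" if z: "z \<noteq> 0" for z
  proof -
    have "d * (\<tau> + \<delta> * z + \<rho> * z\<^sup>2) = z * ((\<delta> + \<tau> * inverse z + \<rho> * z) * d)"
      using z by (simp add: field_simps power2_eq_square)
    also have "\<dots> = C * (z - r) * (1 - s * z)"
      using det[OF z] unfolding det_symb_schur[OF z] d_def .
    finally show ?thesis using d by (simp add: field_simps)
  qed
  define C' where "C' = C / d"
  have e1: "\<tau> + \<delta> + \<rho> = C' * ((1 - r) * (1 - s))" using eq[of 1] by (simp add: C'_def)
  have e2: "\<tau> - \<delta> + \<rho> = C' * ((- 1 - r) * (1 + s))" using eq[of "-1"] by (simp add: C'_def)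
  have e3: "\<tau> + 2 * \<delta> + 4 * \<rho> = C' * ((2 - r) * (1 - 2 * s))" using eq[of 2] by (simp add: C'_def mult.commute)
  have "2 * \<delta> = (\<tau> + \<delta> + \<rho>) - (\<tau> - \<delta> + \<rho>)" by simp
  also have "\<dots> = 2 * (C' * (1 + r * s))" unfolding e1 e2 by (simp add: algebra_simps)
  finally have \<delta>: "\<delta> = C' * (1 + r * s)" by simp
  have "3 * \<rho> = (\<tau> + 2 * \<delta> + 4 * \<rho>) - (\<tau> + \<delta> + \<rho>) - \<delta>" by simp
  also have "\<dots> = 3 * (- C' * s)" unfolding e1 e3 unfolding \<delta> by (simp add: algebra_simps)
  finally have \<rho>: "\<rho> = - C' * s" by simp
  have "\<tau> = (\<tau> + \<delta> + \<rho>) - \<delta> - \<rho>" by simp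
  also have "\<dots> = - C' * r" unfolding e1 unfolding \<delta> \<rho> by (simp add: algebra_simps)
  finally have \<tau>: "\<tau> = - C' * r" .
  have "C' \<noteq> 0" using C d by (simp add: C'_def)
  then show ?thesis by (rule resolvent_exists[OF _ r s \<delta> \<tau> \<rho>])
qed

lemma det_symb_cis:
  assumes "\<And>z. z \<noteq> 0 \<Longrightarrow> z * det (symb k a b c z - mu \<cdot>\<^sub>m 1\<^sub>m k) = q z"
  shows "det (symb k a b c (cis u) - mu \<cdot>\<^sub>m 1\<^sub>m k) = q (cis u) * inverse (cis u)"
proof -
  let ?d = "det (symb k a b c (cis u) - mu \<cdot>\<^sub>m 1\<^sub>m k)"
  have z: "cis u \<noteq> 0" by simp
  have "?d = (cis u * inverse (cis u)) * ?d" using right_inverse[OF z] by (simp only: mult_1)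
  also have "\<dots> = (cis u * ?d) * inverse (cis u)" by (simp only: ac_simps)
  finally show ?thesis unfolding assms[OF z] .
qed

theorem theorem2p6:
  fixes k :: nat and a b c :: "nat \<Rightarrow> complex"
  assumes "k \<ge> 1"
  shows "sigma_det k a b c \<union> sigma_wind k a b c \<subseteq> op_spectrum (ktoep k a b c)
     \<and> op_spectrum (ktoep k a b c) \<subseteq>
         sigma_det k a b c \<union> sigma_wind k a b c \<union> {mu. eigenvalue (B0 k a b c) mu}"
proof -
  have sandwich: "(mu \<in> sigma_wind k a b c \<longrightarrow> mu \<in> op_spectrum (ktoep k a b c))
      \<and> (mu \<in> op_spectrum (ktoep k a b c) \<longrightarrow> mu \<in> sigma_wind k a b c \<or> eigenvalue (B0 k a b c) mu)"
    if nd: "mu \<notin> sigma_det k a b c" for mu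
  proof -
    let ?det = "\<lambda>z. det (symb k a b c z - mu \<cdot>\<^sub>m 1\<^sub>m k)"
    have wind: "mu \<in> sigma_wind k a b c \<longleftrightarrow> winding_number (\<lambda>t. ?det (cis (2 * pi * t))) 0 \<noteq> 0"
      using nd by (simp add: sigma_wind_def)
    obtain \<alpha> \<beta> \<gamma> where q: "\<And>z. z \<noteq> 0 \<Longrightarrow> z * ?det z = \<beta> + \<alpha> * z + \<gamma> * z\<^sup>2"
      using det_symb_quadratic[OF assms, of a b c mu] by blast
    have nz: "\<beta> + \<alpha> * z + \<gamma> * z\<^sup>2 \<noteq> 0" if z: "cmod z = 1" for z
    proof -
      have "z \<noteq> 0" "?det z \<noteq> 0" using z nd by (auto simp: sigma_det_def)
      then show ?thesis using q[of z] by (metis mult_eq_0_iff)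
    qed
    show ?thesis
    proof (rule quadratic_trichotomy[of \<beta> \<alpha> \<gamma>, OF nz])
      fix C s1 s2 :: complex
      assume h: "C \<noteq> 0" "cmod s1 < 1" "cmod s2 < 1"
        and coef: "\<beta> = C" "\<alpha> = - C * (s1 + s2)" "\<gamma> = C * s1 * s2"
      have f: "z * ?det z = C * (1 - s1 * z) * (1 - s2 * z)" if "z \<noteq> 0" for z
        unfolding q[OF that] coef by (simp add: algebra_simps power2_eq_square)
      have "?det (cis u) = C * (1 - s1 * cis u) * (1 - s2 * cis u) * inverse (cis u)" for u
        by (rule det_symb_cis[where q = "\<lambda>z. C * (1 - s1 * z) * (1 - s2 * z)"]) (rule f)
      then have "mu \<in> sigma_wind k a b c"
        unfolding wind by (simp only: winding_number_outside[OF h]) simp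
      then show ?thesis using op_spectrum_if_outside[OF assms h f] by simp
    next
      fix C r s :: complex
      assume h: "C \<noteq> 0" "cmod r < 1" "cmod s < 1"
        and coef: "\<beta> = - C * r" "\<alpha> = C * (1 + r * s)" "\<gamma> = - C * s"
      have f: "z * ?det z = C * (z - r) * (1 - s * z)" if "z \<noteq> 0" for z
        unfolding q[OF that] coef by (simp add: algebra_simps power2_eq_square)
      have "?det (cis u) = C * (cis u - r) * (1 - s * cis u) * inverse (cis u)" for u
        by (rule det_symb_cis[where q = "\<lambda>z. C * (z - r) * (1 - s * z)"]) (rule f)
      then have "mu \<notin> sigma_wind k a b c"
        unfolding wind by (simp only: winding_number_mixed[OF h])
      then show ?thesis using not_op_spectrum_if_mixed[OF assms h f] by blast
    next
      fix C r1 r2 :: complex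
      assume h: "C \<noteq> 0" "cmod r1 < 1" "cmod r2 < 1"
        and coef: "\<beta> = C * r1 * r2" "\<alpha> = - C * (r1 + r2)" "\<gamma> = C"
      have f: "z * ?det z = C * (z - r1) * (z - r2)" if "z \<noteq> 0" for z
        unfolding q[OF that] coef by (simp add: algebra_simps power2_eq_square)
      have "?det (cis u) = C * (cis u - r1) * (cis u - r2) * inverse (cis u)" for u
        by (rule det_symb_cis[where q = "\<lambda>z. C * (z - r1) * (z - r2)"]) (rule f)
      then have "mu \<in> sigma_wind k a b c"
        unfolding wind by (simp only: winding_number_inside[OF h]) simp
      then show ?thesis using op_spectrum_if_inside[OF assms h f] by simp
    qed
  qed
  have "sigma_wind k a b c \<inter> sigma_det k a b c = {}" by (auto simp: sigma_wind_def)
  then show ?thesis using sandwich sigma_det_subset_spectrum[OF assms, of a b c] by blast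
qed

end
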